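(* Let $G$ be an exceptional strongly regular graph with parameters $(v,k,\lambda,\mu)$. Then $k/\Lambda(G) > v^{1/10}/2$.
   Context: A graph is strongly regular with parameters $(v,k,\lambda,\mu)$ if it is a $k$-regular graph on $v$ vertices such that each edge lies in exactly $\lambda$ triangles and any two distinct non-adjacent vertices have exactly $\mu$ common neighbours; complete and edgeless graphs are excluded. For a $k$-regular graph $G$ on $v$ vertices with adjacency eigenvalues $k=\lambda_1\ge\lambda_2\ge\dots\ge\lambda_v$, set $\Lambda(G)=\max\{|\lambda_i| : 2\le i\le v\}$. A connected strongly regular graph is called exceptional if it is not one of the following: (i) a complete multipartite graph $K_{m,m,\dots,m}$ (all parts of equal size $m$); (ii) a Latin square graph: given $m-2$ mutually orthogonal Latin squares of order $n$ (with $m\ge 2$ allowed, $m=2$ meaning no squares), the vertices are the $n^2$ cells, and two cells are adjacent if they lie in the same row, or the same column, or have the same entry in one of the squares; (iii) a Steiner graph: the vertices are the blocks of a Steiner system $S(2,m,n)$ (a family of $m$-subsets of an $n$-set such that any two points lie in a unique block; $m=2$ allowed), two blocks being adjacent iff they intersect. *)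

theory Defs
  imports "Jordan_Normal_Form.Char_Poly" "HOL-Computational_Algebra.Polynomial"
begin

definition simple_graph :: "nat \<Rightarrow> (nat \<Rightarrow> nat \<Rightarrow> bool) \<Rightarrow> bool" where
  "simple_graph v E \<longleftrightarrow>
     (\<forall>x y. E x y \<longrightarrow> x < v \<and> y < v) \<and> (\<forall>x y. E x y \<longrightarrow> E y x) \<and> (\<forall>x. \<not> E x x)"

definition connected_graph :: "nat \<Rightarrow> (nat \<Rightarrow> nat \<Rightarrow> bool) \<Rightarrow> bool" where
  "connected_graph v E \<longleftrightarrow> (\<forall>x<v. \<forall>y<v. E\<^sup>*\<^sup>* x y)"

definition strongly_regular ::
  "nat \<Rightarrow> (nat \<Rightarrow> nat \<Rightarrow> bool) \<Rightarrow> nat \<Rightarrow> nat \<Rightarrow> nat \<Rightarrow> bool" where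
  "strongly_regular v E k lam mu \<longleftrightarrow>
     simple_graph v E \<and>
     (\<forall>x<v. card {y. y < v \<and> E x y} = k) \<and>
     (\<forall>x<v. \<forall>y<v. E x y \<longrightarrow> card {z. z < v \<and> E x z \<and> E y z} = lam) \<and>
     (\<forall>x<v. \<forall>y<v. x \<noteq> y \<and> \<not> E x y \<longrightarrow> card {z. z < v \<and> E x z \<and> E y z} = mu) \<and>
     \<not> (\<forall>x<v. \<forall>y<v. x \<noteq> y \<longrightarrow> E x y) \<and>
     \<not> (\<forall>x y. \<not> E x y)"

definition adj_matrix :: "nat \<Rightarrow> (nat \<Rightarrow> nat \<Rightarrow> bool) \<Rightarrow> real mat" where
  "adj_matrix v E = mat v v (\<lambda>(i, j). if E i j then 1 else 0)"

text \<open>Eigenvalues with multiplicity in non-increasing order (real roots of the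
  characteristic polynomial; for the symmetric adjacency matrix these are all of them).\<close>
definition eigenvalues_desc :: "nat \<Rightarrow> (nat \<Rightarrow> nat \<Rightarrow> bool) \<Rightarrow> real list" where
  "eigenvalues_desc v E = rev (sorted_list_of_multiset (proots (char_poly (adj_matrix v E))))"

text \<open>Lambda(G) = max { |lambda_i| : 2 <= i <= v } (1-based indexing of the eigenvalues).\<close>
definition Lambda_graph :: "nat \<Rightarrow> (nat \<Rightarrow> nat \<Rightarrow> bool) \<Rightarrow> real" where
  "Lambda_graph v E =
     (let xs = eigenvalues_desc v E in Max {\<bar>xs ! i\<bar> | i. 1 \<le> i \<and> i < length xs})"

definition complete_multipartite_equal :: "nat \<Rightarrow> (nat \<Rightarrow> nat \<Rightarrow> bool) \<Rightarrow> bool" where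
  "complete_multipartite_equal v E \<longleftrightarrow>
     (\<exists>(part :: nat \<Rightarrow> nat) m.
        (\<forall>x<v. card {y. y < v \<and> part y = part x} = m) \<and>
        (\<forall>x<v. \<forall>y<v. E x y \<longleftrightarrow> part x \<noteq> part y))"

definition latin_square :: "nat \<Rightarrow> (nat \<times> nat \<Rightarrow> nat) \<Rightarrow> bool" where
  "latin_square n L \<longleftrightarrow>
     (\<forall>i<n. bij_betw (\<lambda>j. L (i, j)) {0..<n} {0..<n}) \<and>
     (\<forall>j<n. bij_betw (\<lambda>i. L (i, j)) {0..<n} {0..<n})"

definition orthogonal_squares :: "nat \<Rightarrow> (nat \<times> nat \<Rightarrow> nat) \<Rightarrow> (nat \<times> nat \<Rightarrow> nat) \<Rightarrow> bool" where
  "orthogonal_squares n L1 L2 \<longleftrightarrow>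
     bij_betw (\<lambda>c. (L1 c, L2 c)) ({0..<n} \<times> {0..<n}) ({0..<n} \<times> {0..<n})"

definition latin_square_graph :: "nat \<Rightarrow> (nat \<Rightarrow> nat \<Rightarrow> bool) \<Rightarrow> bool" where
  "latin_square_graph v E \<longleftrightarrow>
     (\<exists>(n::nat) (m::nat) (L :: nat \<Rightarrow> nat \<times> nat \<Rightarrow> nat) (phi :: nat \<Rightarrow> nat \<times> nat).
        m \<ge> 2 \<and>
        (\<forall>a < m - 2. latin_square n (L a)) \<and>
        (\<forall>a < m - 2. \<forall>b < m - 2. a \<noteq> b \<longrightarrow> orthogonal_squares n (L a) (L b)) \<and>
        bij_betw phi {0..<v} ({0..<n} \<times> {0..<n}) \<and>
        (\<forall>x<v. \<forall>y<v. E x y \<longleftrightarrow>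
           x \<noteq> y \<and> (fst (phi x) = fst (phi y) \<or> snd (phi x) = snd (phi y) \<or>
                      (\<exists>a < m - 2. L a (phi x) = L a (phi y)))))"

definition steiner_system :: "nat set \<Rightarrow> nat set set \<Rightarrow> nat \<Rightarrow> bool" where
  "steiner_system X B m \<longleftrightarrow>
     finite X \<and> (\<forall>b\<in>B. b \<subseteq> X \<and> card b = m) \<and>
     (\<forall>p\<in>X. \<forall>q\<in>X. p \<noteq> q \<longrightarrow> (\<exists>!b. b \<in> B \<and> p \<in> b \<and> q \<in> b))"

definition steiner_graph :: "nat \<Rightarrow> (nat \<Rightarrow> nat \<Rightarrow> bool) \<Rightarrow> bool" where
  "steiner_graph v E \<longleftrightarrow>
     (\<exists>X B (m::nat) (phi :: nat \<Rightarrow> nat set).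
        m \<ge> 2 \<and> steiner_system X B m \<and>
        bij_betw phi {0..<v} B \<and>
        (\<forall>x<v. \<forall>y<v. E x y \<longleftrightarrow> x \<noteq> y \<and> phi x \<inter> phi y \<noteq> {}))"

definition exceptional_srg ::
  "nat \<Rightarrow> (nat \<Rightarrow> nat \<Rightarrow> bool) \<Rightarrow> nat \<Rightarrow> nat \<Rightarrow> nat \<Rightarrow> bool" where
  "exceptional_srg v E k lam mu \<longleftrightarrow>
     strongly_regular v E k lam mu \<and> connected_graph v E \<and>
     \<not> complete_multipartite_equal v E \<and> \<not> latin_square_graph v E \<and> \<not> steiner_graph v E"

end

theory Submission
  imports Defs
begin

text \<open>
  Let \<open>r\<close> and \<open>- m\<close> be the eigenvalues of the graph other than \<open>k\<close>, so that \<open>r - m = lam - mu\<close> and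
  \<open>r m = k - mu\<close>. The orthogonal projection onto either eigenspace has one value on the diagonal and
  two values off it, and therefore \<open>v - 1 \<le> 2 f\<^sup>2\<close> for the multiplicity \<open>f\<close> of either eigenvalue
  (absolute bound). With \<open>v \<le> k\<^sup>2 + 1\<close> this settles the case \<open>r \<le> m\<close>. If \<open>m \<le> r\<close>, then \<open>m\<close> is an
  integer, and if the claim fails, the absolute bound forces \<open>r \<ge> 31 m\<^sup>4\<close> and \<open>r \<ge> 21 m\<^sup>2 mu\<close>.
  For such large \<open>r\<close> the claw argument of Bose, Laskar and Neumaier applies: every maximal claw has
  exactly \<open>m\<close> leaves, the large maximal cliques partition the edges with \<open>m\<close> of them through each
  vertex, and since each of them has at most \<open>1 + k / m\<close> vertices, all attain this bound and form the
  lines of a partial geometry. The number \<open>a = mu / m\<close> of lines through a point that meet a line not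
  containing it is at most \<open>m\<close>. If \<open>a = m\<close>, the graph is a Steiner graph; if \<open>a = m - 1\<close>, it is a
  Latin square graph; if \<open>a \<le> m - 2\<close>, the absolute bound for the intersection graph of the lines
  contradicts \<open>r \<ge> 31 m\<^sup>4\<close>.
\<close>

section \<open>Orthogonal projections with few distinct entries\<close>

text \<open>With \<open>t\<close> the ratio of \<open>k\<close> to the larger of \<open>r\<close>
  and \<open>m\<close>, the claim follows from \<open>v < 1024 * t ^ 10\<close>, where 1024 is the
  tenth power of 2. The exponent comes from the case \<open>r \<le> m\<close>: there the absolute
  bound gives no more than \<open>m \<le> 17 * t ^ 4\<close>, hence
  \<open>k \<le> 17 * t ^ 5\<close>, and \<open>v\<close> is about the square of this at most. The
  two size conditions on \<open>r\<close> have different jobs. Domination over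
  \<open>m\<^sup>2 * mu\<close> makes the counts for claws and cliques strict; domination over
  \<open>m ^ 4\<close> excludes the intermediate values of \<open>a\<close>. The intersection graph
  of the lines helps there because one of its multiplicities is bounded in terms of \<open>m\<close>
  alone, whereas the number of lines grows with their size. Cliques attaining their size bound
  matter beyond the count: tightness makes the number of neighbours on a line the same for all
  points off it, which is the remaining axiom of a partial geometry. Spectral arguments use the
  explicit matrices \<open>proj\<close>, idempotent by the quadratic identity for the adjacency
  matrix. The characteristic polynomial enters only when \<open>Lambda_graph\<close> is compared
  with \<open>r\<close> and \<open>m\<close>.\<close>

lemma homogeneous_system_nontrivial:
  fixes h :: "'i \<Rightarrow> 'a \<Rightarrow> 'f::field"
  assumes "finite I" "finite V" "card I < card V"
  shows "\<exists>c. (\<exists>x\<in>V. c x \<noteq> 0) \<and> (\<forall>i\<in>I. (\<Sum>x\<in>V. c x * h i x) = 0)"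
  using assms
proof (induction I arbitrary: V h rule: finite_induct)
  case empty
  then have "V \<noteq> {}" by auto
  then show ?case by (intro exI[of _ "\<lambda>_. 1"]) auto
next
  case (insert i0 I)
  show ?case
  proof (cases "\<forall>x\<in>V. h i0 x = 0")
    case True
    have "card I < card V" using insert by simp
    from insert.IH[OF insert.prems(1) this] obtain c where
      "\<exists>x\<in>V. c x \<noteq> 0" "\<forall>i\<in>I. (\<Sum>x\<in>V. c x * h i x) = 0" by blast
    moreover have "(\<Sum>x\<in>V. c x * h i0 x) = 0" using True by simp
    ultimately show ?thesis by blast
  next
    case False
    then obtain x0 where x0: "x0 \<in> V" "h i0 x0 \<noteq> 0" by blast
    define W where "W = V - {x0}"
    have W: "finite W" "V = insert x0 W" "x0 \<notin> W"
      using insert.prems x0 by (auto simp: W_def)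
    have "card I < card W" using insert W by simp
    \<comment> \<open>The pivot equation \<open>i0\<close> is solved for the unknown at
      \<open>x0\<close>; substituting the solution into equation \<open>i\<close> leaves these
      coefficients on \<open>W\<close>.\<close>
    from insert.IH[OF W(1) this, of "\<lambda>i x. h i x - h i x0 * h i0 x / h i0 x0"]
    obtain c where c: "\<exists>x\<in>W. c x \<noteq> 0"
      "\<And>i. i \<in> I \<Longrightarrow> (\<Sum>x\<in>W. c x * (h i x - h i x0 * h i0 x / h i0 x0)) = 0" by blast
    define S where "S = (\<Sum>x\<in>W. c x * h i0 x)"
    define d where "d = c(x0 := - S / h i0 x0)"
    have dW: "(\<Sum>x\<in>V. d x * h i x) = - S / h i0 x0 * h i x0 + (\<Sum>x\<in>W. c x * h i x)" for i
    proof -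
      have "(\<Sum>x\<in>W. d x * h i x) = (\<Sum>x\<in>W. c x * h i x)"
        using W by (intro sum.cong) (auto simp: d_def)
      then show ?thesis using W by (simp add: d_def)
    qed
    have "(\<Sum>x\<in>V. d x * h i0 x) = 0" unfolding dW using x0 by (simp add: S_def)
    moreover have "(\<Sum>x\<in>V. d x * h i x) = 0" if "i \<in> I" for i
    proof -
      have "(\<Sum>x\<in>W. c x * (h i x - h i x0 * h i0 x / h i0 x0))
          = (\<Sum>x\<in>W. c x * h i x) - (\<Sum>x\<in>W. (h i x0 / h i0 x0) * (c x * h i0 x))"
        by (simp add: sum_subtractf[symmetric] algebra_simps)
      also have "\<dots> = (\<Sum>x\<in>W. c x * h i x) - h i x0 / h i0 x0 * S"
        by (simp add: S_def sum_distrib_left)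
      finally show ?thesis using c(2)[OF that] unfolding dW by (simp add: algebra_simps)
    qed
    moreover have "\<exists>x\<in>V. d x \<noteq> 0" using c(1) W by (auto simp: d_def)
    ultimately show ?thesis by (intro exI[of _ d]) auto
  qed
qed

text \<open>Orthogonal projections as symmetric idempotent matrices indexed by a set, so that no
  ordering of the vertices has to be chosen.\<close>

definition projection_on :: "'a set \<Rightarrow> ('a \<Rightarrow> 'a \<Rightarrow> real) \<Rightarrow> bool" where
  "projection_on V G \<longleftrightarrow>
     (\<forall>x\<in>V. \<forall>y\<in>V. G x y = G y x) \<and> (\<forall>x\<in>V. \<forall>y\<in>V. (\<Sum>z\<in>V. G x z * G z y) = G x y)"

lemma projection_on_diag:
  assumes "projection_on V G" "x \<in> V"
  shows "G x x = (\<Sum>z\<in>V. (G x z)\<^sup>2)"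
proof -
  have "(\<Sum>z\<in>V. G x z * G z x) = G x x" using assms unfolding projection_on_def by blast
  then have "G x x = (\<Sum>z\<in>V. G x z * G z x)" by simp
  also have "\<dots> = (\<Sum>z\<in>V. (G x z)\<^sup>2)"
    using assms by (intro sum.cong) (auto simp: projection_on_def power2_eq_square)
  finally show ?thesis .
qed

text \<open>Peeling off the normalised nonzero columns one at a time lowers the trace by one each time;
  in particular the trace is a natural number.\<close>
lemma projection_on_decompose:
  fixes G :: "'a \<Rightarrow> 'a \<Rightarrow> real"
  assumes "finite V" "projection_on V G"
  obtains f :: nat and U :: "nat \<Rightarrow> 'a \<Rightarrow> real"
  where "(\<Sum>x\<in>V. G x x) = real f"
    and "\<And>x y. x \<in> V \<Longrightarrow> y \<in> V \<Longrightarrow> G x y = (\<Sum>i<f. U i x * U i y)"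
proof -
  \<comment> \<open>The induction runs over a natural strict upper bound \<open>n\<close> of the
    trace, since the trace is not yet known to be an integer.\<close>
  have "\<exists>(f::nat) U. (\<Sum>x\<in>V. G x x) = real f \<and>
          (\<forall>x\<in>V. \<forall>y\<in>V. G x y = (\<Sum>i<f. U i x * U i y))"
    if "(\<Sum>x\<in>V. G x x) < real n" "projection_on V G" for n and G :: "'a \<Rightarrow> 'a \<Rightarrow> real"
    using that
  proof (induction n arbitrary: G)
    case 0
    have "(\<Sum>x\<in>V. G x x) \<ge> 0"
      by (intro sum_nonneg) (simp add: projection_on_diag[OF 0(2)] sum_nonneg)
    with 0 show ?case by simp
  next
    case (Suc n)
    have sym: "\<And>x y. x \<in> V \<Longrightarrow> y \<in> V \<Longrightarrow> G x y = G y x"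
      and idem: "\<And>x y. x \<in> V \<Longrightarrow> y \<in> V \<Longrightarrow> (\<Sum>z\<in>V. G x z * G z y) = G x y"
      using Suc.prems by (auto simp: projection_on_def)
    show ?case
    proof (cases "\<forall>x\<in>V. G x x = 0")
      case True
      have "G x y = 0" if "x \<in> V" "y \<in> V" for x y
      proof -
        have "(\<Sum>z\<in>V. (G x z)\<^sup>2) = 0"
          using projection_on_diag[OF Suc.prems(2) that(1)] True that by simp
        then show ?thesis using assms(1) that by (simp add: sum_nonneg_eq_0_iff)
      qed
      then show ?thesis by (intro exI[of _ 0]) simp
    next
      case False
      then obtain p where p: "p \<in> V" "G p p \<noteq> 0" by blast
      have pos: "G p p > 0"
        using projection_on_diag[OF Suc.prems(2) p(1)] p
        by (metis less_eq_real_def sum_nonneg zero_le_power2)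
      \<comment> \<open>As \<open>G u = u\<close> and \<open>u\<close> has length one, subtracting
        the rank-one projection onto \<open>u\<close> leaves a projection.\<close>
      define u where "u = (\<lambda>x. G x p / sqrt (G p p))"
      have Gu: "(\<Sum>z\<in>V. G x z * u z) = u x" if "x \<in> V" for x
        using idem[OF that p(1)] by (simp add: u_def sum_divide_distrib[symmetric])
      have u1: "(\<Sum>z\<in>V. u z * u z) = 1"
      proof -
        have "(\<Sum>z\<in>V. u z * u z) = (\<Sum>z\<in>V. G p z * G z p / G p p)"
          using sym p pos by (intro sum.cong) (auto simp: u_def)
        also have "\<dots> = 1" using idem[OF p(1) p(1)] pos by (simp add: sum_divide_distrib[symmetric])
        finally show ?thesis .
      qed
      define H where "H = (\<lambda>x y. G x y - u x * u y)"
      have "projection_on V H"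
        unfolding projection_on_def
      proof (intro conjI ballI)
        fix x y assume xy: "x \<in> V" "y \<in> V"
        show "H x y = H y x" using sym[OF xy] by (simp add: H_def)
        have "(\<Sum>z\<in>V. H x z * H z y) = (\<Sum>z\<in>V. G x z * G z y) - u y * (\<Sum>z\<in>V. G x z * u z)
             - u x * (\<Sum>z\<in>V. u z * G z y) + u x * u y * (\<Sum>z\<in>V. u z * u z)"
          by (simp add: H_def algebra_simps sum_subtractf sum.distrib sum_distrib_left)
        also have "(\<Sum>z\<in>V. u z * G z y) = (\<Sum>z\<in>V. G y z * u z)"
          using sym xy by (intro sum.cong) auto
        finally show "(\<Sum>z\<in>V. H x z * H z y) = H x y"
          using xy Gu u1 idem by (simp add: H_def)
      qed
      moreover have tr: "(\<Sum>x\<in>V. H x x) = (\<Sum>x\<in>V. G x x) - 1"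
        using u1 by (simp add: H_def sum_subtractf)
      ultimately obtain f W where f: "(\<Sum>x\<in>V. H x x) = real f"
        and W: "\<forall>x\<in>V. \<forall>y\<in>V. H x y = (\<Sum>i<f. W i x * W i y)"
        using Suc.IH[of H] Suc.prems by auto
      have "G x y = (\<Sum>i<Suc f. (W(f := u)) i x * (W(f := u)) i y)" if "x \<in> V" "y \<in> V" for x y
      proof -
        have "(\<Sum>i<f. (W(f := u)) i x * (W(f := u)) i y) = (\<Sum>i<f. W i x * W i y)"
          by (intro sum.cong) auto
        moreover have "H x y = (\<Sum>i<f. W i x * W i y)" using W that by blast
        ultimately show ?thesis by (simp add: H_def)
      qed
      then show ?thesis using f tr by (intro exI[of _ "Suc f"] exI[of _ "W(f := u)"]) auto
    qed
  qed
  moreover obtain n :: nat where "(\<Sum>x\<in>V. G x x) < real n" using reals_Archimedean2 by blast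
  ultimately show ?thesis using assms(2) that by blast
qed

text \<open>The entries of the projection are inner products of vectors in dimension \<open>f\<close>, and the quadratic
  polynomial \<open>(t - a) (t - b)\<close> separates the diagonal from the rest, which makes the \<open>card V\<close>
  associated quadratic functions linearly independent.\<close>
lemma two_distance_bound:
  fixes G :: "'a \<Rightarrow> 'a \<Rightarrow> real"
  assumes fin: "finite V" and G: "projection_on V G"
    and diag: "\<And>x. x \<in> V \<Longrightarrow> G x x = d"
    and off: "\<And>x y. x \<in> V \<Longrightarrow> y \<in> V \<Longrightarrow> x \<noteq> y \<Longrightarrow> G x y = a \<or> G x y = b"
    and "a \<noteq> d" "b \<noteq> d"
  obtains f :: nat where "real (card V) * d = real f" "card V \<le> f\<^sup>2 + f + 1"
proof -
  obtain f :: nat and U where tr: "(\<Sum>x\<in>V. G x x) = real f"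
    and U: "\<And>x y. x \<in> V \<Longrightarrow> y \<in> V \<Longrightarrow> G x y = (\<Sum>i<f. U i x * U i y)"
    using projection_on_decompose[OF fin G] by blast
  have "real (card V) * d = real f" using tr diag by simp
  moreover have "card V \<le> f\<^sup>2 + f + 1"
  proof (rule ccontr)
    assume large: "\<not> card V \<le> f\<^sup>2 + f + 1"
    \<comment> \<open>Coordinates of a quadratic function in \<open>f\<close> variables: products
      over ordered pairs, the \<open>f\<close> linear terms and the constant.\<close>
    define I where "I = ({..<f} \<times> {..<f}) <+> ({..<f} <+> {()})"
    define h where "h = (\<lambda>(i :: nat \<times> nat + nat + unit) x. case i of Inl (i, j) \<Rightarrow> U i x * U j x
                                | Inr (Inl i) \<Rightarrow> U i x | Inr (Inr _) \<Rightarrow> 1)"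
    have "finite I" "card I = f\<^sup>2 + f + 1"
      by (auto simp: I_def card_Plus power2_eq_square)
    with large obtain c where c: "\<exists>x\<in>V. c x \<noteq> 0" "\<And>i. i \<in> I \<Longrightarrow> (\<Sum>x\<in>V. c x * h i x) = 0"
      using homogeneous_system_nontrivial[of I V h] fin by auto
    have c2: "(\<Sum>x\<in>V. c x * (U i x * U j x)) = 0" if "i < f" "j < f" for i j
      using c(2)[of "Inl (i, j)"] that by (auto simp: I_def h_def)
    have c1: "(\<Sum>x\<in>V. c x * U i x) = 0" if "i < f" for i
      using c(2)[of "Inr (Inl i)"] that by (auto simp: I_def h_def)
    have "Inr (Inr ()) \<in> I" unfolding I_def by (intro InrI) simp
    from c(2)[OF this] have c0: "(\<Sum>x\<in>V. c x) = 0" by (simp add: h_def)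
    have "c y = 0" if y: "y \<in> V" for y
    proof -
      have e1: "(\<Sum>x\<in>V. c x * G x y) = 0"
      proof -
        have "(\<Sum>x\<in>V. c x * G x y) = (\<Sum>x\<in>V. \<Sum>i<f. U i y * (c x * U i x))"
          using y by (intro sum.cong) (auto simp: U sum_distrib_left mult_ac)
        also have "\<dots> = (\<Sum>i<f. U i y * (\<Sum>x\<in>V. c x * U i x))"
          by (subst sum.swap) (simp add: sum_distrib_left)
        finally show ?thesis using c1 by simp
      qed
      have e2: "(\<Sum>x\<in>V. c x * (G x y * G x y)) = 0"
      proof -
        have "(\<Sum>x\<in>V. c x * (G x y * G x y))
            = (\<Sum>x\<in>V. \<Sum>i<f. \<Sum>j<f. U i y * U j y * (c x * (U i x * U j x)))"
          using y by (intro sum.cong) (auto simp: U sum_product sum_distrib_left mult_ac)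
        also have "\<dots> = (\<Sum>i<f. \<Sum>x\<in>V. \<Sum>j<f. U i y * U j y * (c x * (U i x * U j x)))"
          by (rule sum.swap)
        also have "\<dots> = (\<Sum>i<f. \<Sum>j<f. \<Sum>x\<in>V. U i y * U j y * (c x * (U i x * U j x)))"
          by (intro sum.cong refl sum.swap)
        also have "\<dots> = (\<Sum>i<f. \<Sum>j<f. U i y * U j y * (\<Sum>x\<in>V. c x * (U i x * U j x)))"
          by (simp add: sum_distrib_left)
        finally show ?thesis using c2 by simp
      qed
      have "(\<Sum>x\<in>V. c x * ((G x y - a) * (G x y - b))) = (\<Sum>x\<in>V. c x * (G x y * G x y))
          - (a + b) * (\<Sum>x\<in>V. c x * G x y) + a * b * (\<Sum>x\<in>V. c x)"
        by (simp add: algebra_simps sum_subtractf sum.distrib sum_distrib_left)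
      then have "(\<Sum>x\<in>V. c x * ((G x y - a) * (G x y - b))) = 0" using e1 e2 c0 by simp
      moreover have "(\<Sum>x\<in>V. c x * ((G x y - a) * (G x y - b)))
          = (\<Sum>x\<in>V. if x = y then c y * ((d - a) * (d - b)) else 0)"
        using off diag y by (intro sum.cong) auto
      ultimately show ?thesis using fin y assms(5,6) by simp
    qed
    with c(1) show False by blast
  qed
  ultimately show ?thesis using that by blast
qed

section \<open>Strongly regular graphs\<close>

text \<open>Expands one entry of the square of a matrix that is the sum of an arbitrary and a
  diagonal one, shifted by the constant \<open>e\<close>.\<close>

lemma sum_shifted_product:
  fixes e :: "'b :: comm_ring_1"
  shows "(\<Sum>z\<in>V. (a z + d z - e) * (a' z + d' z - e)) = (\<Sum>z\<in>V. a z * a' z)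
    + (\<Sum>z\<in>V. a z * d' z) + (\<Sum>z\<in>V. d z * a' z) + (\<Sum>z\<in>V. d z * d' z)
    - e * (\<Sum>z\<in>V. a z) - e * (\<Sum>z\<in>V. a' z) - e * (\<Sum>z\<in>V. d z) - e * (\<Sum>z\<in>V. d' z)
    + of_nat (card V) * (e * e)"
  by (simp add: algebra_simps sum.distrib sum_subtractf sum_distrib_left)

text \<open>\<open>mu > 0\<close> stands for connectedness and \<open>mu < k\<close> for not being
  complete multipartite; \<open>exceptional_imp_srg\<close> derives both. The vertex type is
  arbitrary because the locale is also interpreted with the lines of a partial geometry as
  vertices.\<close>

locale srg =
  fixes V :: "'a set" and E :: "'a \<Rightarrow> 'a \<Rightarrow> bool" and k lam mu :: nat
  assumes finV: "finite V"
    and edge_in: "E x y \<Longrightarrow> x \<in> V \<and> y \<in> V"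
    and sym: "E x y \<Longrightarrow> E y x"
    and irrefl: "\<not> E x x"
    and deg: "x \<in> V \<Longrightarrow> card {y. E x y} = k"
    and adj: "E x y \<Longrightarrow> card {z. E x z \<and> E y z} = lam"
    and nonadj: "x \<in> V \<Longrightarrow> y \<in> V \<Longrightarrow> x \<noteq> y \<Longrightarrow> \<not> E x y \<Longrightarrow> card {z. E x z \<and> E y z} = mu"
    and not_complete: "\<exists>x\<in>V. \<exists>y\<in>V. x \<noteq> y \<and> \<not> E x y"
    and mu_pos: "mu > 0" and mu_less: "mu < k"
begin

lemma finN: "finite {y. E x y}"
  by (rule finite_subset[OF _ finV]) (use edge_in in auto)

lemma finNN: "finite {z. E x z \<and> E y z}"
  by (rule finite_subset[OF _ finN[of x]]) auto

definition A :: "'a \<Rightarrow> 'a \<Rightarrow> real" where "A x y = (if E x y then 1 else 0)"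

definition v :: real where "v = real (card V)"

lemma A_sym: "A x y = A y x"
  using sym by (auto simp: A_def)

lemma sum_A: "x \<in> V \<Longrightarrow> (\<Sum>y\<in>V. A x y) = real k"
proof -
  assume x: "x \<in> V"
  have "{y\<in>V. E x y} = {y. E x y}" using edge_in by auto
  then show ?thesis using deg[OF x] finV by (simp add: A_def sum.If_cases Int_def)
qed

text \<open>Entries of the squared adjacency matrix count common neighbours. The spectral facts
  below rest on this identity.\<close>

lemma A_square:
  assumes "x \<in> V" "y \<in> V"
  shows "(\<Sum>z\<in>V. A x z * A z y) =
    real mu + (real lam - real mu) * A x y + (if x = y then real k - real mu else 0)"
proof -
  have "(\<Sum>z\<in>V. A x z * A z y) = (\<Sum>z\<in>V. if E x z \<and> E y z then 1 else 0)"
    using sym by (intro sum.cong) (auto simp: A_def)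
  also have "\<dots> = real (card {z\<in>V. E x z \<and> E y z})"
    using finV by (simp add: sum.If_cases Int_def)
  also have "{z\<in>V. E x z \<and> E y z} = {z. E x z \<and> E y z}" using edge_in by auto
  finally show ?thesis
    using assms deg[of x] adj[of x y] nonadj[of x y] irrefl by (cases "x = y"; cases "E x y") (auto simp: A_def)
qed

text \<open>Summing \<open>A_square\<close> along a row evaluates the matrix identity on the
  constant vector.\<close>

lemma mu_count: "real mu * (v - 1 - real k) = real k * (real k - 1 - real lam)"
proof -
  obtain x where x: "x \<in> V" using not_complete by blast
  have "(\<Sum>y\<in>V. \<Sum>z\<in>V. A x z * A z y) = (\<Sum>z\<in>V. \<Sum>y\<in>V. A x z * A z y)"
    by (rule sum.swap)
  also have "\<dots> = (\<Sum>z\<in>V. A x z * real k)"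
    by (simp add: sum_distrib_left[symmetric] sum_A)
  also have "\<dots> = real k * real k" using x by (simp add: sum_distrib_right[symmetric] sum_A)
  finally have "real k * real k = (\<Sum>y\<in>V. real mu + (real lam - real mu) * A x y + (if x = y then real k - real mu else 0))"
    using x A_square by simp
  also have "\<dots> = v * real mu + (real lam - real mu) * real k + (real k - real mu)"
    using x finV by (simp add: sum.distrib sum_distrib_left[symmetric] sum_A v_def)
  finally show ?thesis by (simp add: algebra_simps)
qed

text \<open>Otherwise, for a common neighbour \<open>z\<close> of non-adjacent \<open>x\<close> and
  \<open>y\<close>, all neighbours of \<open>z\<close> except \<open>x\<close> would be adjacent to
  \<open>x\<close>, and \<open>y\<close> is one of them.\<close>

lemma lam_less: "lam + 1 < k"
proof (rule ccontr)
  assume "\<not> lam + 1 < k"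
  obtain x y where xy: "x \<in> V" "y \<in> V" "x \<noteq> y" "\<not> E x y" using not_complete by blast
  then have "{z. E x z \<and> E y z} \<noteq> {}" using nonadj mu_pos by fastforce
  then obtain z where z: "E x z" "E y z" by blast
  have "insert x {w. E x w \<and> E z w} = {w. E z w}"
  proof (rule card_subset_eq[OF finN])
    show "insert x {w. E x w \<and> E z w} \<subseteq> {w. E z w}" using z sym by auto
    have "card (insert x {w. E x w \<and> E z w}) = lam + 1" using finNN irrefl adj[OF z(1)] by simp
    moreover have "card (insert x {w. E x w \<and> E z w}) \<le> card {w. E z w}"
      by (rule card_mono[OF finN]) (use z sym in auto)
    ultimately show "card (insert x {w. E x w \<and> E z w}) = card {w. E z w}"
      using deg[of z] edge_in z \<open>\<not> lam + 1 < k\<close> by force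
  qed
  moreover have "y \<in> {w. E z w}" using z sym by simp
  ultimately have "y \<in> insert x {w. E x w \<and> E z w}" by simp
  then show False using xy by simp
qed

text \<open>\<open>r\<close> and \<open>- m\<close> are the roots of
  \<open>t\<^sup>2 - (lam - mu) t - (k - mu)\<close>, the polynomial that annihilates the adjacency
  matrix on vectors with coordinate sum zero; \<open>sqD\<close> is the root of its
  discriminant.\<close>

definition sqD :: real where
  "sqD = sqrt ((real lam - real mu)\<^sup>2 + 4 * (real k - real mu))"
definition r :: real where "r = (sqD + (real lam - real mu)) / 2"
definition m :: real where "m = (sqD - (real lam - real mu)) / 2"

lemma sqD_square: "sqD\<^sup>2 = (real lam - real mu)\<^sup>2 + 4 * (real k - real mu)"
  unfolding sqD_def using mu_less by simp

lemma r_minus_m: "r - m = real lam - real mu" by (simp add: r_def m_def field_simps)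

lemma r_plus_m: "r + m = sqD" by (simp add: r_def m_def field_simps)

lemma r_times_m: "r * m = real k - real mu"
proof -
  have "r * m = (sqD\<^sup>2 - (real lam - real mu)\<^sup>2) / 4"
    by (simp add: r_def m_def power2_eq_square field_simps)
  then show ?thesis by (simp add: sqD_square)
qed

lemma r_pos: "r > 0" and m_pos: "m > 0"
proof -
  have "sqD > \<bar>real lam - real mu\<bar>"
    unfolding sqD_def using mu_less by (intro real_less_rsqrt) simp
  then show "r > 0" "m > 0" by (auto simp: r_def m_def)
qed

lemma k_eq: "real k = real mu + r * m" using r_times_m by simp
lemma lam_eq: "real lam = real mu + r - m" using r_minus_m by simp

lemma k_lam_eq: "real k - 1 - real lam = (r + 1) * (m - 1)"
  by (simp add: k_eq lam_eq algebra_simps)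

lemma m_gt_1: "m > 1"
proof -
  have "(r + 1) * (m - 1) > 0" using lam_less k_lam_eq by linarith
  then show ?thesis using r_pos by (simp add: zero_less_mult_iff)
qed

lemma v_eq: "real mu * (v - 1) = real k * (real k + m - 1 - r)"
proof -
  have "real mu * (v - 1) = real mu * (v - 1 - real k) + real mu * real k" by (simp add: algebra_simps)
  also have "\<dots> = real k * ((real k - 1 - real lam) + real mu)" unfolding mu_count by (simp add: algebra_simps)
  finally show ?thesis by (simp add: lam_eq algebra_simps)
qed

text \<open>This is \<open>(A - r I) (A + m I) = mu J\<close>, with \<open>J\<close> the all-ones
  matrix, read on the constant vector.\<close>

lemma v_mu: "real mu * v = (real k - r) * (real k + m)"
proof -
  have "real mu * v = real k * (real k + m - 1 - r) + real mu" using v_eq by (simp add: algebra_simps)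
  also have "\<dots> = (real k - r) * (real k + m)"
    by (simp add: k_eq algebra_simps)
  finally show ?thesis .
qed

lemma v_pos: "v > 0"
  unfolding v_def using finV not_complete by (auto simp: card_gt_0_iff)

text \<open>For \<open>c = m\<close> and \<open>c = - r\<close> this is the orthogonal projection onto the eigenspace
  of \<open>r\<close> and of \<open>- m\<close>, respectively.\<close>
definition proj :: "real \<Rightarrow> 'a \<Rightarrow> 'a \<Rightarrow> real" where
  "proj c x y = (A x y + (if x = y then c else 0) - (real k + c) / v) / (real lam - real mu + 2 * c)"

lemma projection_on_proj:
  assumes "c = m \<or> c = - r"
  shows "projection_on V (proj c)"
proof -
  define w where "w = real lam - real mu + 2 * c"
  define e where "e = (real k + c) / v"
  define B where "B = (\<lambda>x y. A x y + (if x = y then c else 0) - e)"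
  have w0: "w \<noteq> 0" using assms r_minus_m r_pos m_pos by (auto simp: w_def)
  \<comment> \<open>\<open>cw\<close> and \<open>ew\<close> compare the coefficients of the identity
    and of the all-ones matrix in the desired equation \<open>B\<^sup>2 = w B\<close>.\<close>
  have cw: "(real k - real mu) + c * c = w * c"
    unfolding w_def k_eq lam_eq using assms by (auto simp: algebra_simps)
  have ew: "real mu - e * (real k + c) = - w * e"
  proof -
    have "(real k + c) * (real k + c - w) = real mu * v"
      unfolding w_def v_mu lam_eq using assms by (auto simp: algebra_simps)
    then show ?thesis using v_pos by (simp add: e_def field_simps)
  qed
  have "(\<Sum>z\<in>V. B x z * B z y) = w * B x y" if xy: "x \<in> V" "y \<in> V" for x y
  proof -
    have d1: "(\<Sum>z\<in>V. (if x = z then c else 0) * A z y) = c * A x y"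
    proof -
      have "(\<Sum>z\<in>V. (if x = z then c else 0) * A z y) = (\<Sum>z\<in>V. if x = z then c * A x y else 0)"
        by (intro sum.cong) auto
      then show ?thesis using xy finV by simp
    qed
    have d2: "(\<Sum>z\<in>V. A x z * (if z = y then c else 0)) = c * A x y"
    proof -
      have "(\<Sum>z\<in>V. A x z * (if z = y then c else 0)) = (\<Sum>z\<in>V. if z = y then c * A x y else 0)"
        by (intro sum.cong) auto
      then show ?thesis using xy finV by simp
    qed
    have d3: "(\<Sum>z\<in>V. (if x = z then c else 0) * (if z = y then c else 0)) = (if x = y then c * c else 0)"
    proof -
      have "(\<Sum>z\<in>V. (if x = z then c else 0) * (if z = y then c else 0))
        = (\<Sum>z\<in>V. if x = z then (if x = y then c * c else 0) else 0)"
        by (intro sum.cong) auto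
      then show ?thesis using xy finV by simp
    qed
    have d4: "(\<Sum>z\<in>V. (if x = z then c else 0)) = c" "(\<Sum>z\<in>V. (if z = y then c else 0)) = c"
      using xy finV by auto
    have d5: "(\<Sum>z\<in>V. A x z) = k" "(\<Sum>z\<in>V. A z y) = k"
      using xy sum_A[of x] sum_A[of y] by (auto simp: A_sym[of _ y])
    have "(\<Sum>z\<in>V. B x z * B z y) = (\<Sum>z\<in>V. A x z * A z y)
        + (\<Sum>z\<in>V. A x z * (if z = y then c else 0)) + (\<Sum>z\<in>V. (if x = z then c else 0) * A z y)
        + (\<Sum>z\<in>V. (if x = z then c else 0) * (if z = y then c else 0))
        - e * (\<Sum>z\<in>V. A x z) - e * (\<Sum>z\<in>V. A z y)
        - e * (\<Sum>z\<in>V. (if x = z then c else 0)) - e * (\<Sum>z\<in>V. (if z = y then c else 0)) + v * (e * e)"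
      unfolding B_def v_def by (rule sum_shifted_product)
    also have "\<dots> = (\<Sum>z\<in>V. A x z * A z y) + 2 * c * A x y + (if x = y then c * c else 0)
        - 2 * e * (real k + c) + v * (e * e)"
      unfolding d1 d2 d3 d4 d5 by (simp add: algebra_simps)
    also have "v * (e * e) = e * (real k + c)" using v_pos by (simp add: e_def)
    also have "(\<Sum>z\<in>V. A x z * A z y) = real mu + (w - 2 * c) * A x y + (if x = y then real k - real mu else 0)"
      using A_square[OF xy] by (simp add: w_def)
    finally have "(\<Sum>z\<in>V. B x z * B z y) = w * A x y + (if x = y then (real k - real mu) + c * c else 0)
        + (real mu - e * (real k + c))"
      by (simp add: algebra_simps)
    then show ?thesis unfolding cw ew by (simp add: B_def algebra_simps)
  qed
  moreover have pB: "proj c x y = B x y / w" for x y by (simp add: proj_def B_def e_def w_def)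
  ultimately show ?thesis
    using w0 A_sym by (auto simp: projection_on_def pB sum_divide_distrib[symmetric] B_def)
qed

text \<open>The trace of \<open>proj c\<close> gives the equation. Up to shift and scale its entries
  are \<open>c\<close> on the diagonal and 1 or 0 elsewhere, so \<open>c\<close> must avoid 0 and 1;
  for \<open>c = m\<close> this uses \<open>m > 1\<close>. Finally \<open>f\<^sup>2 + f + 1\<close>
  is relaxed by \<open>f \<le> f\<^sup>2\<close>.\<close>

lemma absolute_bound:
  assumes "c = m \<or> c = - r"
  obtains f :: nat where "real f * (real lam - real mu + 2 * c) = (v - 1) * c - real k"
    and "v - 1 \<le> 2 * (real f)\<^sup>2"
proof -
  define w where "w = real lam - real mu + 2 * c"
  have w0: "w \<noteq> 0" using assms r_minus_m r_pos m_pos by (auto simp: w_def)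
  have c: "c \<noteq> 0" "c \<noteq> 1" using assms m_gt_1 r_pos by auto
  define e where "e = (real k + c) / v"
  obtain f :: nat where f: "real (card V) * ((c - e) / w) = real f" "card V \<le> f\<^sup>2 + f + 1"
  proof (rule two_distance_bound[OF finV projection_on_proj[OF assms], of "(c - e) / w" "(1 - e) / w" "- e / w"])
    show "\<And>x. x \<in> V \<Longrightarrow> proj c x x = (c - e) / w" by (simp add: proj_def A_def irrefl e_def w_def)
    show "\<And>x y. x \<in> V \<Longrightarrow> y \<in> V \<Longrightarrow> x \<noteq> y \<Longrightarrow> proj c x y = (1 - e) / w \<or> proj c x y = - e / w"
      by (simp add: proj_def A_def e_def w_def)
    show "(1 - e) / w \<noteq> (c - e) / w" "- e / w \<noteq> (c - e) / w"
      using c w0 by (auto simp: divide_simps)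
  qed
  have 1: "real f * w = (v - 1) * c - real k"
  proof -
    have "real f * w = v * (c - e)" unfolding f(1)[symmetric] v_def using w0 by simp
    also have "\<dots> = v * c - (real k + c)" using v_pos by (simp add: e_def field_simps)
    finally show ?thesis by (simp add: algebra_simps)
  qed
  have "f \<le> f\<^sup>2" by (simp add: power2_eq_square)
  then have "card V \<le> 2 * f\<^sup>2 + 1" using f(2) by linarith
  then have "v \<le> real (2 * f\<^sup>2 + 1)" unfolding v_def of_nat_le_iff .
  then have "v - 1 \<le> 2 * (real f)\<^sup>2" by simp
  with 1 that show ?thesis by (simp add: w_def)
qed

text \<open>Here \<open>f\<close> is the multiplicity of \<open>r\<close>; in the next lemma
  \<open>g\<close> is that of \<open>- m\<close>.\<close>

lemma absolute_bound_r:
  obtains f :: nat where "real f * (r + m) = (v - 1) * m - real k" "v - 1 \<le> 2 * (real f)\<^sup>2"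
proof -
  have *: "real lam - real mu + 2 * m = r + m" using r_minus_m by simp
  show ?thesis using absolute_bound[of m] that unfolding * by blast
qed

lemma absolute_bound_m:
  obtains g :: nat where "real g * (r + m) = (v - 1) * r + real k" "v - 1 \<le> 2 * (real g)\<^sup>2"
proof -
  have *: "real lam - real mu + 2 * (-r) = - (r + m)" using r_minus_m by simp
  obtain g :: nat where g: "real g * - (r + m) = (v - 1) * - r - real k" "v - 1 \<le> 2 * (real g)\<^sup>2"
    using absolute_bound[of "- r"] unfolding * by blast
  show ?thesis by (rule that[OF _ g(2)]) (use g(1) in \<open>simp add: algebra_simps\<close>)
qed

text \<open>The graph has diameter two: \<open>mu \<ge> 1\<close> in \<open>mu_count\<close> gives
  \<open>v \<le> 1 + k + k (k - 1)\<close>.\<close>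

lemma v_le_k_square: "v \<le> (real k)\<^sup>2 + 1"
proof -
  have "v - 1 - real k \<ge> 0"
  proof -
    have "real mu * (v - 1 - real k) \<ge> 0" unfolding mu_count using lam_less by (intro mult_nonneg_nonneg) auto
    then show ?thesis using mu_pos by (simp add: zero_le_mult_iff)
  qed
  then have "v - 1 - real k \<le> real mu * (v - 1 - real k)" using mu_pos by (simp add: mult_le_cancel_right1)
  also have "\<dots> \<le> real k * (real k - 1)" unfolding mu_count by (intro mult_left_mono) auto
  finally show ?thesis by (simp add: power2_eq_square algebra_simps)
qed

text \<open>The product \<open>(k + r) (k - m)\<close> is the value of
  \<open>(t - r) (t + m)\<close> at \<open>t = - k\<close>; expanded in the parameters it is visibly
  positive.\<close>

lemma m_less_k: "m < real k"
proof (rule ccontr)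
  assume "\<not> m < real k"
  then have "(real k + r) * (real k - m) \<le> 0" using r_pos by (intro mult_nonneg_nonpos) auto
  moreover have "(real k + r) * (real k - m) = real k * (real k - 1 - real mu) + real k * real lam + real mu"
    by (simp add: k_eq lam_eq algebra_simps)
  moreover have "real k * (real k - 1 - real mu) \<ge> 0" using mu_less by (intro mult_nonneg_nonneg) auto
  moreover have "real k * real lam \<ge> 0" by simp
  ultimately show False using mu_pos by linarith
qed

end

lemma Ints_if_Rats_square_int:
  fixes x :: real
  assumes "x \<in> \<rat>" "x\<^sup>2 = of_int n"
  shows "x \<in> \<int>"
proof -
  obtain a b :: nat where ab: "b \<noteq> 0" "\<bar>x\<bar> = real a / real b" "coprime a b"
    using Rats_abs_nat_div_natE[OF assms(1)] by metis
  have "(real a / real b)\<^sup>2 = of_int n" using assms(2) ab(2) by (metis power2_abs)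
  then have "real_of_int ((int a)\<^sup>2) = real_of_int (n * (int b)\<^sup>2)"
    using ab(1) by (simp add: field_simps)
  then have "(int a)\<^sup>2 = n * (int b)\<^sup>2" unfolding of_int_eq_iff .
  then have "int b dvd (int a)\<^sup>2" by (simp add: power2_eq_square)
  moreover have "coprime (int b) ((int a)\<^sup>2)" using ab(3) by (simp add: coprime_commute)
  ultimately have "is_unit (int b)" by (metis coprime_common_divisor dvd_refl)
  then have "\<bar>x\<bar> = of_int (int a)" using ab(2) by simp
  then have "x = of_int (int a) \<or> x = of_int (- int a)" by (auto simp: abs_if split: if_splits)
  then show ?thesis using Ints_of_int by metis
qed

section \<open>Numerical consequences of the absolute bound\<close>

context srg begin

text \<open>In the main case \<open>v - 1 \<le> 2 g\<^sup>2\<close> and the formula for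
  \<open>g\<close> give \<open>m\<^sup>2 \<le> 8 (v - 1) r\<^sup>2\<close>. Multiplied by
  \<open>mu\<close>, with \<open>mu (v - 1) \<le> 2 k\<^sup>2\<close> and \<open>r \<le> t\<close>,
  this becomes \<open>mu \<le> 16 t ^ 4\<close>; then \<open>m \<le> mu + r\<close> bounds
  \<open>m\<close>, then \<open>k = t m\<close>, then \<open>v\<close>.\<close>

lemma v_bound_if_r_le_m:
  assumes "r \<le> m"
  shows "v < 1024 * (real k / m) ^ 10"
proof -
  define t where "t = real k / m"
  have k: "real k = t * m" using m_pos by (simp add: t_def)
  have t1: "1 \<le> t" using m_less_k m_pos by (simp add: t_def)
  have rt: "r \<le> t" using k_eq m_pos mu_pos by (simp add: t_def pos_le_divide_eq)
  have p: "t ^ i \<le> t ^ j" if "i \<le> j" for i j using t1 that by (rule power_increasing[rotated])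
  have p1: "1 \<le> t ^ i" for i using t1 by simp
  obtain g :: nat where g: "real g * (r + m) = (v - 1) * r + real k" "v - 1 \<le> 2 * (real g)\<^sup>2"
    using absolute_bound_m .
  show ?thesis
  \<comment> \<open>Small \<open>g\<close> bounds \<open>v\<close> directly. For
    \<open>g > 2 t\<close> the term \<open>k = t m\<close> is at most half of \<open>g m\<close> and
    can be absorbed.\<close>
  proof (cases "real g \<le> 2 * t")
    case True
    then have "(real g)\<^sup>2 \<le> (2 * t)\<^sup>2" by (intro power_mono) auto
    then have "v - 1 \<le> 8 * t ^ 2" using g(2) by (simp add: power_mult_distrib)
    also have "\<dots> \<le> 8 * t ^ 10" using p[of 2 10] by simp
    finally show ?thesis using p1[of 10] unfolding t_def[symmetric] by linarith
  next
    case False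
    have "v > 1"
    proof -
      have "real k * (real k + m - 1 - r) > 0"
        using assms m_less_k m_gt_1 by (intro mult_pos_pos) auto
      then have "real mu * (v - 1) > 0" unfolding v_eq .
      then show ?thesis using mu_pos by (simp add: zero_less_mult_iff)
    qed
    have "real g * m + real g * r = (v - 1) * r + t * m" using g(1) k by (simp add: algebra_simps)
    moreover have "real g * r \<ge> 0" using r_pos by simp
    moreover have "t * m \<le> real g / 2 * m" using False m_pos by (intro mult_right_mono) auto
    ultimately have "real g * m \<le> 2 * ((v - 1) * r)" by linarith
    then have "real g * m \<le> 2 * (v - 1) * r" by (simp only: mult.assoc)
    then have "(real g * m)\<^sup>2 \<le> (2 * (v - 1) * r)\<^sup>2" using m_pos by (intro power_mono) auto
    moreover have "(v - 1) * m\<^sup>2 \<le> 2 * (real g)\<^sup>2 * m\<^sup>2" using g(2) by (intro mult_right_mono) auto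
    ultimately have "(v - 1) * m\<^sup>2 \<le> (v - 1) * (8 * (v - 1) * r\<^sup>2)"
      by (simp add: power_mult_distrib power2_eq_square algebra_simps)
    then have "m\<^sup>2 \<le> 8 * (v - 1) * r\<^sup>2" using \<open>v > 1\<close> by simp
    then have "real mu * m\<^sup>2 \<le> real mu * (8 * (v - 1) * r\<^sup>2)" by (intro mult_left_mono) auto
    also have "\<dots> = 8 * r\<^sup>2 * (real mu * (v - 1))" by simp
    also have "\<dots> \<le> 8 * r\<^sup>2 * (real k * (2 * real k))"
      unfolding v_eq using m_less_k r_pos by (intro mult_left_mono) auto
    also have "\<dots> = (16 * r\<^sup>2 * t\<^sup>2) * m\<^sup>2" by (simp add: k power2_eq_square)
    finally have "real mu \<le> 16 * r\<^sup>2 * t\<^sup>2" using m_pos by simp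
    also have "\<dots> \<le> 16 * t\<^sup>2 * t\<^sup>2" using rt r_pos by (intro mult_right_mono mult_left_mono power_mono) auto
    finally have "real mu \<le> 16 * t ^ 4" by (simp add: power2_eq_square power4_eq_xxxx)
    moreover have "m \<le> real mu + r" using lam_eq by linarith
    ultimately have "m \<le> 17 * t ^ 4" using rt p[of 1 4] by simp
    then have "real k \<le> t * (17 * t ^ 4)" unfolding k using t1 by (intro mult_left_mono) auto
    then have "real k \<le> 17 * t ^ 5" by (simp add: eval_nat_numeral)
    then have "(real k)\<^sup>2 \<le> (17 * t ^ 5)\<^sup>2" by (intro power_mono) auto
    then have "(real k)\<^sup>2 \<le> 289 * t ^ 10" by (simp add: power_mult_distrib power_mult[symmetric])
    then show ?thesis using v_le_k_square p1[of 10] unfolding t_def[symmetric] by linarith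
  qed
qed

lemma v_gt_1: "v > 1"
proof -
  obtain x y where "x \<in> V" "y \<in> V" "x \<noteq> y" using not_complete by blast
  then have "card {x, y} \<le> card V" using finV by (intro card_mono) auto
  then show ?thesis using \<open>x \<noteq> y\<close> by (simp add: v_def)
qed

text \<open>The assumption and \<open>mu (v - 1) \<le> k\<^sup>2\<close> give
  \<open>1023 mu t ^ 8 \<le> r\<^sup>2\<close>, and \<open>31\<^sup>2 = 961\<close> lies below 1023.
  The second bound needs in addition that \<open>mu\<close> is at most of order
  \<open>m ^ 4\<close>, which comes from the absolute bound for the multiplicity of
  \<open>r\<close>.\<close>

lemma large_r:
  assumes "m \<le> r" "v \<ge> 1024 * (real k / r) ^ 10"
  shows "31 * m ^ 4 \<le> r" "21 * m\<^sup>2 * real mu \<le> r"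
proof -
  define t where "t = real k / r"
  have k: "real k = t * r" using r_pos by (simp add: t_def)
  have mt: "m \<le> t" using k_eq r_pos mu_pos by (simp add: t_def pos_le_divide_eq mult.commute)
  then have t1: "1 \<le> t" using m_gt_1 by simp
  have p1: "1 \<le> t ^ i" for i using t1 by simp
  have v1: "v - 1 \<ge> 1023 * t ^ 10" using assms(2) p1[of 10] unfolding t_def[symmetric] by linarith
  have vk: "real mu * (v - 1) \<le> (t * r)\<^sup>2"
    unfolding v_eq using assms(1) m_gt_1 by (simp add: k[symmetric] power2_eq_square mult_left_mono)
  have "real mu * (1023 * t ^ 10) \<le> real mu * (v - 1)" using v1 by (intro mult_left_mono) auto
  also note vk
  finally have "t\<^sup>2 * (1023 * real mu * t ^ 8) \<le> t\<^sup>2 * r\<^sup>2"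
    by (simp add: power_mult_distrib algebra_simps power_add[symmetric])
  then have r2: "1023 * real mu * t ^ 8 \<le> r\<^sup>2" using t1 by simp
  have "(31 * t ^ 4)\<^sup>2 = 961 * t ^ 8" by (simp add: power_mult_distrib power_mult[symmetric])
  also have "\<dots> \<le> 1023 * real mu * t ^ 8" using mu_pos p1[of 8] by (intro mult_right_mono) auto
  also note r2
  finally have r31: "31 * t ^ 4 \<le> r" by (rule power2_le_imp_le) (use r_pos in simp)
  have "m ^ 4 \<le> t ^ 4" using mt m_pos by (intro power_mono) auto
  with r31 show "31 * m ^ 4 \<le> r" by simp
  obtain f :: nat where f: "real f * (r + m) = (v - 1) * m - real k" "v - 1 \<le> 2 * (real f)\<^sup>2"
    using absolute_bound_r .
  have "real f * r + real f * m = (v - 1) * m - real k" using f(1) by (simp add: algebra_simps)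
  moreover have "real f * m \<ge> 0" using m_pos by simp
  ultimately have "real f * r \<le> (v - 1) * m" by linarith
  then have "(real f * r)\<^sup>2 \<le> ((v - 1) * m)\<^sup>2" using r_pos by (intro power_mono) auto
  moreover have "(v - 1) * r\<^sup>2 \<le> 2 * (real f)\<^sup>2 * r\<^sup>2" using f(2) by (intro mult_right_mono) auto
  ultimately have "(v - 1) * r\<^sup>2 \<le> (v - 1) * (2 * (v - 1) * m\<^sup>2)"
    by (simp add: power_mult_distrib power2_eq_square algebra_simps)
  then have "r\<^sup>2 \<le> 2 * (v - 1) * m\<^sup>2" using v_gt_1 by simp
  then have "real mu * r\<^sup>2 \<le> real mu * (2 * (v - 1) * m\<^sup>2)" by (intro mult_left_mono) auto
  also have "\<dots> = 2 * m\<^sup>2 * (real mu * (v - 1))" by simp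
  also have "\<dots> \<le> 2 * m\<^sup>2 * (t * r)\<^sup>2" using vk by (intro mult_left_mono) auto
  also have "\<dots> = (2 * m\<^sup>2 * t\<^sup>2) * r\<^sup>2" by (simp add: power_mult_distrib)
  finally have mu1: "real mu \<le> 2 * m\<^sup>2 * t\<^sup>2" using r_pos by simp
  also have "\<dots> \<le> 2 * t\<^sup>2 * t\<^sup>2" using mt m_pos by (intro mult_right_mono mult_left_mono power_mono) auto
  \<comment> \<open>Thus \<open>mu\<close> is small compared with \<open>r\<close>, so
    \<open>k\<close> is close to \<open>r m\<close> and \<open>t\<close> exceeds \<open>m\<close> by
    a factor of at most \<open>33 / 31\<close>. This sharpens \<open>mu1\<close> to a bound in
    \<open>m\<close> alone.\<close>
  finally have "31 * real mu \<le> 2 * r" using r31 by (simp add: power2_eq_square power4_eq_xxxx)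
  then have "31 * (real mu + r * m) \<le> (31 * m + 2) * r" by (simp add: algebra_simps)
  then have "31 * real k \<le> 33 * m * r"
    unfolding k_eq[symmetric] using m_gt_1 r_pos by (smt (verit) mult_right_mono)
  then have "31 * t \<le> 33 * m" unfolding k using r_pos by simp
  then have "(31 * t)\<^sup>2 \<le> (33 * m)\<^sup>2" using t1 by (intro power_mono) auto
  then have "961 * t\<^sup>2 \<le> 1089 * m\<^sup>2" by (simp add: power_mult_distrib)
  then have "m\<^sup>2 * (961 * t\<^sup>2) \<le> m\<^sup>2 * (1089 * m\<^sup>2)" by (intro mult_left_mono) auto
  then have "961 * real mu \<le> 2178 * m ^ 4" using mu1 by (simp add: power2_eq_square power4_eq_xxxx)
  then have "real mu * m ^ 4 * (961 * real mu) \<le> real mu * m ^ 4 * (2178 * m ^ 4)"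
    by (intro mult_left_mono) auto
  moreover have "real mu * m ^ 8 \<le> real mu * t ^ 8"
    using mt m_pos by (intro mult_left_mono power_mono) auto
  moreover have "real mu * m ^ 4 * (2178 * m ^ 4) = 2178 * (real mu * m ^ 8)"
    by (simp add: power_add[symmetric])
  moreover have "real mu * m ^ 4 * (961 * real mu) = 961 * ((m\<^sup>2 * real mu)\<^sup>2)"
    by (simp add: power2_eq_square power4_eq_xxxx)
  ultimately have "961 * ((m\<^sup>2 * real mu)\<^sup>2) \<le> 2178 * (real mu * t ^ 8)" by linarith
  moreover have "0 \<le> (m\<^sup>2 * real mu)\<^sup>2" by simp
  \<comment> \<open>The constant 21 is admissible because \<open>441 * 2178 / 961\<close> is less
    than 1023.\<close>
  ultimately have "441 * ((m\<^sup>2 * real mu)\<^sup>2) \<le> 1023 * (real mu * t ^ 8)" by linarith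
  moreover have "(21 * m\<^sup>2 * real mu)\<^sup>2 = 441 * ((m\<^sup>2 * real mu)\<^sup>2)" by (simp add: power_mult_distrib)
  ultimately have "(21 * m\<^sup>2 * real mu)\<^sup>2 \<le> r\<^sup>2" using r2 by simp
  then show "21 * m\<^sup>2 * real mu \<le> r" by (rule power2_le_imp_le) (use r_pos in simp)
qed

text \<open>Subtracting the two multiplicity formulas expresses \<open>(g - f) * sqD\<close>
  rationally. Since \<open>m \<le> r\<close> means \<open>lam \<ge> mu\<close>, the value is
  positive, so \<open>g \<noteq> f\<close> and \<open>sqD\<close> is rational, hence an integer; it
  has the parity of \<open>lam - mu\<close>, so that \<open>m\<close> is an integer too.\<close>

lemma m_integral:
  assumes "m \<le> r"
  obtains n :: nat where "m = real n"
proof -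
  obtain f :: nat where f: "real f * (r + m) = (v - 1) * m - real k" using absolute_bound_r by blast
  obtain g :: nat where g: "real g * (r + m) = (v - 1) * r + real k" using absolute_bound_m by blast
  have "real g * (r + m) - real f * (r + m) = (v - 1) * (r - m) + 2 * real k"
    unfolding f g by (simp add: algebra_simps)
  then have "(real g - real f) * sqD = (v - 1) * (real lam - real mu) + 2 * real k"
    unfolding r_plus_m r_minus_m by (simp add: algebra_simps)
  moreover have "(v - 1) * (real lam - real mu) \<ge> 0"
    using v_gt_1 assms r_minus_m by (intro mult_nonneg_nonneg) auto
  ultimately have fg: "(real g - real f) * sqD = (v - 1) * (real lam - real mu) + 2 * real k"
    "(real g - real f) * sqD > 0" using mu_less by auto
  then have "real g - real f \<noteq> 0" by auto
  then have "sqD = ((v - 1) * (real lam - real mu) + 2 * real k) / (real g - real f)"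
    unfolding fg(1)[symmetric] by simp
  also have "\<dots> \<in> \<rat>" unfolding v_def by (intro Rats_divide Rats_add Rats_mult Rats_diff) auto
  finally have "sqD \<in> \<rat>" .
  moreover have "sqD\<^sup>2 = real_of_int ((int lam - int mu)\<^sup>2 + 4 * (int k - int mu))"
    using sqD_square by simp
  ultimately obtain s :: int where s: "sqD = of_int s"
    using Ints_if_Rats_square_int Ints_cases by metis
  have "s\<^sup>2 = (int lam - int mu)\<^sup>2 + 4 * (int k - int mu)"
  proof -
    have "real_of_int (s\<^sup>2) = real_of_int ((int lam - int mu)\<^sup>2 + 4 * (int k - int mu))"
      using sqD_square s by simp
    then show ?thesis unfolding of_int_eq_iff .
  qed
  then have "even (s\<^sup>2) \<longleftrightarrow> even ((int lam - int mu)\<^sup>2)" by simp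
  then have "even (s - (int lam - int mu))" by simp
  then obtain n where n: "s - (int lam - int mu) = 2 * n" by blast
  have "real_of_int (s - (int lam - int mu)) = real_of_int (2 * n)" unfolding n ..
  then have "m = of_int n" by (simp add: m_def s)
  moreover then have "n \<ge> 0" using m_pos by simp
  ultimately show ?thesis using that[of "nat n"] by simp
qed

end

section \<open>Cliques and claws\<close>

context srg begin

definition clique :: "'a set \<Rightarrow> bool" where
  "clique C \<longleftrightarrow> C \<subseteq> V \<and> (\<forall>x\<in>C. \<forall>y\<in>C. x \<noteq> y \<longrightarrow> E x y)"

lemma clique_finite: "clique C \<Longrightarrow> finite C"
  unfolding clique_def using finV finite_subset by blast

text \<open>The projection onto the eigenspace of \<open>- m\<close> applied to the indicator function of a clique
  has nonnegative squared length; it vanishes exactly when the clique attains the bound.\<close>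
lemma
  assumes C: "clique C" "C \<noteq> {}"
  shows clique_bound: "real (card C) * m \<le> real k + m"
    and clique_tight: "\<lbrakk>real (card C) * m = real k + m; x \<in> V; x \<notin> C\<rbrakk>
      \<Longrightarrow> real (card {y\<in>C. E x y}) * m = real mu"
proof -
  define e where "e = (real k - r) / v"
  define c where "c = real (card C)"
  define G where "G = proj (- r)"
  define h where "h = (\<lambda>z. \<Sum>x\<in>C. G z x)"
  have fC: "finite C" and CV: "C \<subseteq> V" and CE: "\<And>x y. x \<in> C \<Longrightarrow> y \<in> C \<Longrightarrow> x \<noteq> y \<Longrightarrow> E x y"
    using C clique_finite by (auto simp: clique_def)
  have c0: "c > 0" using C fC by (simp add: c_def card_gt_0_iff)
  have w: "real lam - real mu + 2 * (- r) = - (r + m)" using r_minus_m by simp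
  have h: "h z = (c * e - real (card {y\<in>C. E z y}) + (if z \<in> C then r else 0)) / (r + m)" for z
  proof -
    have "h z = (\<Sum>x\<in>C. (A z x + (if z = x then - r else 0) - e) / (- (r + m)))"
      unfolding h_def G_def proj_def w by (simp add: e_def)
    also have "\<dots> = ((\<Sum>x\<in>C. A z x) + (\<Sum>x\<in>C. if z = x then - r else 0) - c * e) / (- (r + m))"
      by (simp only: sum_divide_distrib[symmetric] sum.distrib sum_subtractf sum_constant c_def)
    also have "(\<Sum>x\<in>C. A z x) = real (card {y\<in>C. E z y})"
      using fC by (simp add: A_def sum.If_cases Int_def)
    also have "(\<Sum>x\<in>C. if z = x then - r else 0) = (if z \<in> C then - r else 0)" using fC by simp
    finally show ?thesis using r_pos m_pos by (simp add: field_simps)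
  qed
  have e: "e * (real k + m) = real mu" using v_mu v_pos by (simp add: e_def field_simps)
  have P: "projection_on V G" unfolding G_def by (rule projection_on_proj) simp
  then have idem: "\<And>x y. x \<in> V \<Longrightarrow> y \<in> V \<Longrightarrow> (\<Sum>z\<in>V. G x z * G z y) = G x y"
    unfolding projection_on_def by blast
  have "(\<Sum>z\<in>V. (h z)\<^sup>2) = (\<Sum>z\<in>V. \<Sum>x\<in>C. \<Sum>y\<in>C. G x z * G z y)"
  proof (rule sum.cong[OF refl])
    fix z assume "z \<in> V"
    have "(h z)\<^sup>2 = (\<Sum>x\<in>C. \<Sum>y\<in>C. G z x * G z y)" by (simp add: h_def power2_eq_square sum_product)
    also have "\<dots> = (\<Sum>x\<in>C. \<Sum>y\<in>C. G x z * G z y)"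
      using P CV \<open>z \<in> V\<close> by (intro sum.cong refl) (auto simp: projection_on_def)
    finally show "(h z)\<^sup>2 = (\<Sum>x\<in>C. \<Sum>y\<in>C. G x z * G z y)" .
  qed
  also have "\<dots> = (\<Sum>x\<in>C. \<Sum>z\<in>V. \<Sum>y\<in>C. G x z * G z y)" by (rule sum.swap)
  also have "\<dots> = (\<Sum>x\<in>C. \<Sum>y\<in>C. \<Sum>z\<in>V. G x z * G z y)" by (intro sum.cong refl sum.swap)
  also have "\<dots> = (\<Sum>x\<in>C. \<Sum>y\<in>C. G x y)"
    using idem CV by (intro sum.cong refl) blast
  also have "\<dots> = (\<Sum>x\<in>C. (c * e - (c - 1) + r) / (r + m))"
  proof (rule sum.cong[OF refl])
    fix x assume x: "x \<in> C"
    have "{y\<in>C. E x y} = C - {x}" using CE x irrefl by auto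
    then have "real (card {y\<in>C. E x y}) = c - 1" using x fC c0 by (simp add: c_def)
    then show "(\<Sum>y\<in>C. G x y) = (c * e - (c - 1) + r) / (r + m)"
      using h[of x] x by (simp add: h_def)
  qed
  finally have sq: "(\<Sum>z\<in>V. (h z)\<^sup>2) = c * (c * e - (c - 1) + r) / (r + m)" by (simp add: c_def)
  have km: "real k + m > 0" using m_pos by simp
  \<comment> \<open>Clearing the denominator of \<open>e\<close> shows that the squared length has
    the sign of \<open>k + m - c m\<close>.\<close>
  have ce: "(c * e - (c - 1) + r) * (real k + m) = (r + 1) * (real k + m - c * m)"
  proof -
    have "(c * e - (c - 1) + r) * (real k + m) = c * (e * (real k + m)) - (c - 1 - r) * (real k + m)"
      by (simp add: algebra_simps)
    also have "\<dots> = (r + 1) * (real k + m - c * m)" unfolding e by (simp add: k_eq algebra_simps)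
    finally show ?thesis .
  qed
  have "0 \<le> (\<Sum>z\<in>V. (h z)\<^sup>2)" by (simp add: sum_nonneg)
  then have "c * e - (c - 1) + r \<ge> 0"
    unfolding sq using c0 r_pos m_pos by (simp add: zero_le_divide_iff zero_le_mult_iff)
  then have "(r + 1) * (real k + m - c * m) \<ge> 0" using ce km by (metis mult_nonneg_nonneg less_imp_le)
  then show "real (card C) * m \<le> real k + m" using r_pos by (simp add: c_def zero_le_mult_iff)
  assume eq: "real (card C) * m = real k + m" and x: "x \<in> V" "x \<notin> C"
  have "(c * e - (c - 1) + r) * (real k + m) = 0" using ce eq by (simp add: c_def)
  then have "c * e - (c - 1) + r = 0" using km by simp
  then have "(\<Sum>z\<in>V. (h z)\<^sup>2) = 0" by (simp add: sq)
  \<comment> \<open>Off the clique, the vanishing of \<open>h x\<close> says that \<open>x\<close>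
    has exactly \<open>c e\<close> neighbours in it, whatever \<open>x\<close> is.\<close>
  then have "h x = 0" using x finV by (simp add: sum_nonneg_eq_0_iff)
  then have "real (card {y\<in>C. E x y}) = c * e" using h[of x] x r_pos m_pos by simp
  then have "real (card {y\<in>C. E x y}) * m = (real k + m) * e" using eq by (simp add: c_def mult_ac)
  then show "real (card {y\<in>C. E x y}) * m = real mu" using e by (simp add: mult.commute)
qed

end

text \<open>Natural numbers \<open>M\<close> and \<open>R\<close> in place of the eigenvalues keep
  the counting in \<open>nat\<close>. \<open>R_mu\<close> drives the claw argument;
  \<open>R_M\<close> serves to exclude \<open>a + 2 \<le> M\<close> at the end.\<close>

locale claw_srg = srg +
  fixes M R :: nat
  assumes m_M: "m = real M" and r_R: "r = real R"
    and R_mu: "21 * M\<^sup>2 * mu \<le> R" and R_M: "31 * M ^ 4 \<le> R"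
begin

lemma M_ge: "M \<ge> 2" using m_gt_1 m_M by simp

lemma k_nat: "k = mu + R * M"
proof -
  have "real k = real (mu + R * M)" using k_eq m_M r_R by simp
  then show ?thesis unfolding of_nat_eq_iff .
qed

lemma lam_nat: "lam + M = mu + R"
proof -
  have "real (lam + M) = real (mu + R)" using lam_eq m_M r_R by simp
  then show ?thesis unfolding of_nat_eq_iff .
qed

text \<open>Every product in the following estimates is dominated by \<open>M * M * mu\<close>,
  which turns them into linear arithmetic.\<close>

lemma products: "M * mu \<le> M * M * mu" "M \<le> M * M * mu" "M * M \<le> M * M * mu" "mu \<le> M * M * mu"
    "21 * (M * M * mu) \<le> R" "1 \<le> M * M * mu"
  using M_ge mu_pos R_mu by (auto simp: power2_eq_square)

text \<open>A leaf of a claw together with its neighbours among those of the centre takes up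
  \<open>lam + 1\<close> vertices, so fewer than \<open>M\<close> leaves leave room for another
  one.\<close>

lemma neighbours_not_covered: "s < M \<Longrightarrow> s * (lam + 1) < k"
proof -
  assume "s < M"
  then have "s * (lam + 1) \<le> (M - 1) * (lam + 1)" by (intro mult_right_mono) auto
  also have "\<dots> \<le> (M - 1) * (mu + R)" using lam_nat M_ge by (intro mult_left_mono) auto
  also have "\<dots> + (mu + R) = M * (mu + R)"
    using M_ge by (metis Suc_diff_1 add.commute mult_Suc not_numeral_le_zero gr0I)
  finally have "s * (lam + 1) + (mu + R) \<le> M * mu + R * M" by (simp add: algebra_simps)
  then show ?thesis using products mu_pos unfolding k_nat by linarith
qed

text \<open>A neighbourhood has no room for \<open>M + 1\<close> disjoint sets of size at least
  \<open>lam + 1 - M * mu\<close>. This limits both the leaves of a claw and the lines through a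
  point.\<close>

lemma too_many_large_sets: "k + (M + 1) * (M * mu) < (M + 1) * (lam + 1)"
proof -
  have "M * (lam + M) = M * (mu + R)" by (simp only: lam_nat)
  then have "M * lam + M * M = M * mu + M * R" by (simp add: algebra_simps)
  moreover have "(M + 1) * (lam + 1) = M * lam + lam + M + 1"
    "(M + 1) * (M * mu) = M * M * mu + M * mu" "R * M = M * R" by (simp_all add: algebra_simps)
  ultimately show ?thesis using products lam_nat unfolding k_nat by linarith
qed

lemma lam_large: "mu + 2 * (M * mu) < lam + 2"
  using products lam_nat by linarith

definition claw :: "'a \<Rightarrow> 'a set \<Rightarrow> bool" where
  "claw p S \<longleftrightarrow> (\<forall>x\<in>S. E p x) \<and> (\<forall>x\<in>S. \<forall>y\<in>S. \<not> E x y)"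

lemma claw_finite: "claw p S \<Longrightarrow> finite S"
  by (rule finite_subset[OF _ finN[of p]]) (auto simp: claw_def)

lemma claw_extend:
  assumes "claw p S" "p \<in> V" "card S < M"
  obtains y where "y \<notin> S" "claw p (insert y S)"
proof -
  let ?C = "\<Union>x\<in>S. insert x {y. E p y \<and> E x y}"
  have "card ?C \<le> (\<Sum>x\<in>S. card (insert x {y. E p y \<and> E x y}))"
    by (rule card_UN_le[OF claw_finite[OF assms(1)]])
  also have "\<dots> \<le> (\<Sum>x\<in>S. lam + 1)"
  proof (rule sum_mono)
    fix x assume "x \<in> S"
    then have "E p x" using assms by (simp add: claw_def)
    from adj[OF this] show "card (insert x {y. E p y \<and> E x y}) \<le> lam + 1"
      using card_insert_le_m1[of "lam + 1"] by (simp add: card_insert_if finNN)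
  qed
  also have "\<dots> < k" using neighbours_not_covered[OF assms(3)] by simp
  finally have "card ?C < card {y. E p y}" using deg[OF assms(2)] by simp
  moreover have "finite ?C" using claw_finite[OF assms(1)] finNN by auto
  ultimately have "\<not> {y. E p y} \<subseteq> ?C" using card_mono by (metis not_less)
  then obtain y where y: "E p y" "y \<notin> ?C" by blast
  show ?thesis
    by (rule that[of y]) (use y assms(1) irrefl sym in \<open>auto simp: claw_def\<close>)
qed

definition private_nbrs :: "'a \<Rightarrow> 'a set \<Rightarrow> 'a \<Rightarrow> 'a set" where
  "private_nbrs p S x = insert x {y. E p y \<and> E x y \<and> (\<forall>z\<in>S - {x}. \<not> E z y)}"

lemma private_nbrs_finite: "finite (private_nbrs p S x)"
  unfolding private_nbrs_def by (rule finite.insertI, rule finite_subset[OF _ finN[of p]]) auto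

text \<open>Of the \<open>lam\<close> common neighbours of \<open>p\<close> and \<open>x\<close>,
  each other leaf \<open>z\<close> destroys at most \<open>mu\<close>, because \<open>x\<close> and
  \<open>z\<close> are not adjacent.\<close>

lemma card_private_nbrs:
  assumes "claw p S" "x \<in> S"
  shows "lam + 1 \<le> card (private_nbrs p S x) + (card S - 1) * mu"
proof -
  have px: "E p x" using assms by (simp add: claw_def)
  let ?Q = "{y. E p y \<and> E x y \<and> (\<forall>z\<in>S - {x}. \<not> E z y)}"
  let ?U = "\<Union>z\<in>S - {x}. {y. E x y \<and> E z y}"
  have fS: "finite S" using claw_finite[OF assms(1)] .
  have fQ: "finite ?Q" by (rule finite_subset[OF _ finN[of p]]) auto
  have "card {y. E p y \<and> E x y} \<le> card (?Q \<union> ?U)"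
    using fS fQ finNN by (intro card_mono) auto
  also have "\<dots> \<le> card ?Q + card ?U" by (rule card_Un_le)
  also have "card ?U \<le> (\<Sum>z\<in>S - {x}. card {y. E x y \<and> E z y})"
    using fS by (intro card_UN_le) auto
  also have "\<dots> \<le> (\<Sum>z\<in>S - {x}. mu)"
  proof (rule sum_mono)
    fix z assume z: "z \<in> S - {x}"
    then have "x \<in> V" "z \<in> V" "x \<noteq> z" "\<not> E x z"
      using assms edge_in[of p z] edge_in[of p x] by (auto simp: claw_def)
    then show "card {y. E x y \<and> E z y} \<le> mu" using nonadj by simp
  qed
  also have "\<dots> = (card S - 1) * mu" using assms fS by simp
  finally have "lam \<le> card ?Q + (card S - 1) * mu" using adj[OF px] by simp
  moreover have "card (private_nbrs p S x) = card ?Q + 1"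
    unfolding private_nbrs_def using fQ irrefl by simp
  ultimately show ?thesis by simp
qed

text \<open>The private neighbourhoods of \<open>M + 1\<close> leaves would be disjoint sets of
  neighbours of \<open>p\<close> that are too large to fit.\<close>

lemma claw_card_le:
  assumes "claw p S" "p \<in> V"
  shows "card S \<le> M"
proof (rule ccontr)
  assume "\<not> card S \<le> M"
  then have "M + 1 \<le> card S" by simp
  then obtain T where T: "T \<subseteq> S" "card T = M + 1" by (metis obtain_subset_with_card_n)
  then have cT: "claw p T" using assms by (auto simp: claw_def)
  have fT: "finite T" using claw_finite[OF cT] .
  have "(\<Sum>x\<in>T. card (private_nbrs p T x)) = card (\<Union>x\<in>T. private_nbrs p T x)"
  proof (rule card_UN_disjoint[symmetric, OF fT])
    show "\<forall>i\<in>T. finite (private_nbrs p T i)" using private_nbrs_finite by blast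
    show "\<forall>i\<in>T. \<forall>j\<in>T. i \<noteq> j \<longrightarrow> private_nbrs p T i \<inter> private_nbrs p T j = {}"
      using cT by (auto simp: private_nbrs_def claw_def)
  qed
  also have "\<dots> \<le> card {y. E p y}"
    by (rule card_mono[OF finN]) (use cT in \<open>auto simp: private_nbrs_def claw_def\<close>)
  also have "\<dots> = k" using deg assms by simp
  finally have "(\<Sum>x\<in>T. card (private_nbrs p T x)) \<le> k" .
  moreover have "(\<Sum>x\<in>T. lam + 1) \<le> (\<Sum>x\<in>T. card (private_nbrs p T x) + M * mu)"
    using card_private_nbrs[OF cT] T by (intro sum_mono) simp
  ultimately have "(M + 1) * (lam + 1) \<le> k + (M + 1) * (M * mu)"
    using T by (simp add: sum.distrib)
  then show False using too_many_large_sets by simp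
qed

lemma maximal_claw:
  assumes "E p x"
  obtains S where "claw p S" "x \<in> S" "card S = M"
proof -
  have "\<exists>S. claw p S \<and> x \<in> S \<and> card S = Suc j" if "Suc j \<le> M" for j
    using that
  proof (induction j)
    case 0
    show ?case by (rule exI[of _ "{x}"]) (use assms irrefl in \<open>auto simp: claw_def\<close>)
  next
    case (Suc j)
    then obtain S where S: "claw p S" "x \<in> S" "card S = Suc j" by auto
    obtain y where y: "y \<notin> S" "claw p (insert y S)"
      using claw_extend[OF S(1)] edge_in[OF assms] S Suc.prems by auto
    then show ?case using S claw_finite[OF S(1)] by (intro exI[of _ "insert y S"]) auto
  qed
  from this[of "M - 1"] show ?thesis using M_ge that by auto
qed

text \<open>The threshold, written without subtraction, is a size guaranteed for the centre of a
  claw with \<open>M\<close> leaves together with the private neighbours of one leaf.\<close>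

definition large_clique :: "'a set \<Rightarrow> bool" where
  "large_clique L \<longleftrightarrow> clique L \<and> lam + 2 \<le> card L + M * mu"

text \<open>Two non-adjacent private neighbours of \<open>x\<close> could replace \<open>x\<close> in a claw of maximal size.\<close>
lemma large_clique_through_edge:
  assumes px: "E p x"
  obtains L where "large_clique L" "p \<in> L" "x \<in> L"
proof -
  obtain S where S: "claw p S" "x \<in> S" "card S = M" using maximal_claw[OF px] .
  have fS: "finite S" using claw_finite[OF S(1)] .
  let ?P = "private_nbrs p S x"
  have "p \<notin> ?P" using px irrefl by (auto simp: private_nbrs_def)
  then have "card (insert p ?P) = card ?P + 1" using private_nbrs_finite by simp
  moreover have "lam + 1 \<le> card ?P + M * mu"
    using card_private_nbrs[OF S(1,2)] S(3) by (meson add_left_mono diff_le_self le_trans mult_le_mono1)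
  moreover have "clique (insert p ?P)"
  proof -
    have "E y z" if yz: "y \<in> ?P" "z \<in> ?P" "y \<noteq> z" for y z
    proof (rule ccontr)
      assume n: "\<not> E y z"
      then have ne: "y \<noteq> x" "z \<noteq> x" using yz sym by (auto simp: private_nbrs_def)
      have yS: "y \<notin> S - {x}" "z \<notin> S - {x}"
        using yz ne S by (auto simp: private_nbrs_def claw_def)
      have "claw p (insert y (insert z (S - {x})))"
      proof -
        have "E p y" "E p z" "\<forall>s\<in>S - {x}. \<not> E s y" "\<forall>s\<in>S - {x}. \<not> E s z"
          using yz ne by (auto simp: private_nbrs_def)
        moreover from this have "\<forall>s\<in>S - {x}. \<not> E y s" "\<forall>s\<in>S - {x}. \<not> E z s"
          using sym by blast+
        moreover have "\<not> E z y" using n sym by blast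
        ultimately show ?thesis using S(1) n irrefl by (simp add: claw_def)
      qed
      moreover have "card (insert y (insert z (S - {x}))) = M + 1"
        using yS yz(3) fS S M_ge by simp
      ultimately show False using claw_card_le edge_in[OF px] by fastforce
    qed
    moreover have pP: "E p y" if "y \<in> ?P" for y using that px by (auto simp: private_nbrs_def)
    moreover have "?P \<subseteq> V" using px edge_in by (auto simp: private_nbrs_def)
    moreover have "E y p" if "y \<in> ?P" for y using pP[OF that] by (rule sym)
    ultimately show ?thesis using edge_in[OF px] unfolding clique_def by auto
  qed
  ultimately show ?thesis
    by (intro that[of "insert p ?P"]) (auto simp: large_clique_def private_nbrs_def)
qed

text \<open>If some \<open>c\<close> in \<open>C\<close> and \<open>d\<close> in \<open>D\<close>
  were non-adjacent, the intersection would consist of common neighbours of \<open>c\<close> and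
  \<open>d\<close>, at most \<open>mu\<close>, and the union without \<open>p\<close> and
  \<open>x\<close> of common neighbours of \<open>p\<close> and \<open>x\<close>, at most
  \<open>lam\<close>. By \<open>lam_large\<close> this is too little for two large cliques.\<close>

lemma large_clique_Un:
  assumes C: "large_clique C" and D: "large_clique D"
    and p: "p \<in> C" "p \<in> D" and x: "x \<in> C" "x \<in> D" and px: "p \<noteq> x"
  shows "clique (C \<union> D)"
proof (rule ccontr)
  assume nc: "\<not> clique (C \<union> D)"
  have cC: "clique C" and cD: "clique D" using C D by (auto simp: large_clique_def)
  with nc obtain a b where ab: "a \<in> C \<union> D" "b \<in> C \<union> D" "a \<noteq> b" "\<not> E a b"
    unfolding clique_def by auto
  moreover have "\<not> (a \<in> C \<and> b \<in> C)" "\<not> (a \<in> D \<and> b \<in> D)" using ab cC cD unfolding clique_def by auto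
  moreover have "\<not> E b a" using ab(4) sym by blast
  ultimately obtain c d where cd: "c \<in> C" "d \<in> D" "c \<noteq> d" "\<not> E c d" by blast
  have cV: "c \<in> V" "d \<in> V" using cd cC cD by (auto simp: clique_def)
  have f: "finite C" "finite D" using cC cD clique_finite by auto
  have "c \<notin> D" "d \<notin> C" using cd cC cD unfolding clique_def by blast+
  then have "C \<inter> D \<subseteq> {z. E c z \<and> E d z}"
    using cd cC cD unfolding clique_def by auto
  then have "card (C \<inter> D) \<le> mu"
    using card_mono[OF finNN, of "C \<inter> D" c d] nonadj[OF cV cd(3,4)] by simp
  moreover have "C \<union> D - {p, x} \<subseteq> {z. E p z \<and> E x z}"
    using p x cC cD unfolding clique_def by auto
  then have "card (C \<union> D - {p, x}) \<le> lam"
    using card_mono[OF finNN, of "C \<union> D - {p, x}" p x] adj[of p x] cC p x px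
    unfolding clique_def by auto
  then have "card (C \<union> D) \<le> lam + 2"
    using f p x px by (simp add: card_Diff_subset)
  moreover have "card C + card D = card (C \<union> D) + card (C \<inter> D)" using card_Un_Int f by blast
  ultimately show False using C D lam_large unfolding large_clique_def by linarith
qed

definition lines :: "'a set set" where
  "lines = {L. large_clique L \<and> (\<forall>C. clique C \<longrightarrow> L \<subseteq> C \<longrightarrow> C = L)}"

lemma line_clique: "L \<in> lines \<Longrightarrow> clique L"
  by (simp add: lines_def large_clique_def)

lemma line_through_edge:
  assumes "E p x"
  obtains L where "L \<in> lines" "p \<in> L" "x \<in> L"
proof -
  obtain C where C: "large_clique C" "p \<in> C" "x \<in> C" using large_clique_through_edge[OF assms] .
  let ?F = "{D. clique D \<and> C \<subseteq> D}"
  have "finite ?F" by (rule finite_subset[of _ "Pow V"]) (auto simp: clique_def finV)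
  moreover have "C \<in> ?F" using C by (auto simp: large_clique_def)
  ultimately obtain L where L: "L \<in> ?F" "\<And>D. D \<in> ?F \<Longrightarrow> L \<subseteq> D \<Longrightarrow> D = L"
    using finite_has_maximal2[of ?F C] by (metis (lifting))
  have "card C \<le> card L" using L clique_finite by (auto intro: card_mono)
  then have "large_clique L" using C L by (auto simp: large_clique_def)
  moreover have "\<forall>D. clique D \<longrightarrow> L \<subseteq> D \<longrightarrow> D = L" using L by blast
  ultimately show ?thesis using that[of L] C L by (auto simp: lines_def)
qed

lemma line_unique:
  assumes "L \<in> lines" "L' \<in> lines" "p \<in> L" "x \<in> L" "p \<in> L'" "x \<in> L'" "p \<noteq> x"
  shows "L = L'"
proof -
  have "clique (L \<union> L')" by (rule large_clique_Un) (use assms in \<open>auto simp: lines_def\<close>)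
  then have "L \<union> L' = L" "L \<union> L' = L'" using assms by (auto simp: lines_def)
  then show ?thesis by simp
qed

lemma finite_lines: "finite lines"
  by (rule finite_subset[of _ "Pow V"]) (use line_clique in \<open>auto simp: clique_def finV\<close>)

lemma sum_lines_through:
  assumes "p \<in> V"
  shows "(\<Sum>L\<in>{L\<in>lines. p \<in> L}. card L - 1) = k"
proof -
  let ?Lp = "{L\<in>lines. p \<in> L}"
  have "(\<Sum>L\<in>?Lp. card L - 1) = (\<Sum>L\<in>?Lp. card (L - {p}))"
    by (intro sum.cong) (auto simp: card_Diff_singleton)
  also have "\<dots> = card (\<Union>L\<in>?Lp. L - {p})"
  proof (rule card_UN_disjoint[symmetric])
    show "finite ?Lp" using finite_lines by simp
    show "\<forall>i\<in>?Lp. finite (i - {p})" using line_clique clique_finite by auto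
    show "\<forall>i\<in>?Lp. \<forall>j\<in>?Lp. i \<noteq> j \<longrightarrow> (i - {p}) \<inter> (j - {p}) = {}" using line_unique by blast
  qed
  also have "(\<Union>L\<in>?Lp. L - {p}) = {y. E p y}"
  proof
    show "(\<Union>L\<in>?Lp. L - {p}) \<subseteq> {y. E p y}" using line_clique by (auto simp: clique_def)
    show "{y. E p y} \<subseteq> (\<Union>L\<in>?Lp. L - {p})"
    proof
      fix y assume "y \<in> {y. E p y}"
      then have "E p y" by simp
      then obtain L where "L \<in> lines" "p \<in> L" "y \<in> L" using line_through_edge by blast
      then show "y \<in> (\<Union>L\<in>?Lp. L - {p})" using \<open>E p y\<close> irrefl by auto
    qed
  qed
  also have "card {y. E p y} = k" using deg[OF assms] .
  finally show ?thesis .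
qed

lemma card_line_le:
  assumes "L \<in> lines"
  shows "(card L - 1) * M \<le> k" "L \<noteq> {}"
proof -
  have lc: "lam + 2 \<le> card L + M * mu" using assms by (simp add: lines_def large_clique_def)
  then have c: "card L \<noteq> 0" using lam_large by linarith
  then show "L \<noteq> {}" by auto
  from clique_bound[OF line_clique[OF assms] this] have "real (card L * M) \<le> real (k + M)"
    using m_M by simp
  then have "card L * M \<le> k + M" unfolding of_nat_le_iff .
  then show "(card L - 1) * M \<le> k" by (simp add: diff_mult_distrib)
qed

text \<open>At least \<open>M\<close> lines, since each covers at most \<open>k / M\<close> of the
  \<open>k\<close> neighbours; at most \<open>M\<close> by
  \<open>too_many_large_sets\<close>.\<close>

lemma card_lines_through:
  assumes "p \<in> V"
  shows "card {L\<in>lines. p \<in> L} = M"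
proof -
  let ?Lp = "{L\<in>lines. p \<in> L}"
  have "k * M = (\<Sum>L\<in>?Lp. (card L - 1) * M)"
    unfolding sum_lines_through[OF assms, symmetric] by (simp add: sum_distrib_right)
  also have "\<dots> \<le> (\<Sum>L\<in>?Lp. k)" using card_line_le by (intro sum_mono) auto
  finally have "k * M \<le> k * card ?Lp" by (simp add: mult.commute)
  then have "M \<le> card ?Lp" using mu_less by simp
  moreover have "card ?Lp \<le> M"
  proof (rule ccontr)
    assume "\<not> card ?Lp \<le> M"
    then have "M + 1 \<le> card ?Lp" by simp
    then obtain T where T: "T \<subseteq> ?Lp" "card T = M + 1" by (metis obtain_subset_with_card_n)
    have "(\<Sum>L\<in>T. lam + 1) \<le> (\<Sum>L\<in>T. (card L - 1) + M * mu)"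
    proof (rule sum_mono)
      fix L assume "L \<in> T"
      then have "L \<in> lines" using T by auto
      then have "lam + 2 \<le> card L + M * mu" by (simp add: lines_def large_clique_def)
      then show "lam + 1 \<le> (card L - 1) + M * mu" by simp
    qed
    then have "(M + 1) * (lam + 1) \<le> (\<Sum>L\<in>T. (card L - 1)) + (M + 1) * (M * mu)"
      using T by (simp add: sum.distrib)
    also have "(\<Sum>L\<in>T. (card L - 1)) \<le> (\<Sum>L\<in>?Lp. (card L - 1))"
      using T finite_lines by (intro sum_mono2) auto
    also have "\<dots> = k" using sum_lines_through[OF assms] .
    finally show False using too_many_large_sets by simp
  qed
  ultimately show ?thesis by simp
qed

text \<open>With exactly \<open>M\<close> lines through a point, the nonnegative deficits
  \<open>k - (card L - 1) * M\<close> add up to zero.\<close>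

lemma card_line:
  assumes "L \<in> lines"
  shows "(card L - 1) * M = k" "card L \<ge> 2"
proof -
  obtain p where p: "p \<in> L" using card_line_le[OF assms] by blast
  then have pV: "p \<in> V" using line_clique[OF assms] by (auto simp: clique_def)
  let ?Lp = "{L\<in>lines. p \<in> L}"
  have "(\<Sum>L\<in>?Lp. k - (card L - 1) * M) = (\<Sum>L\<in>?Lp. k) - (\<Sum>L\<in>?Lp. (card L - 1) * M)"
    using card_line_le by (intro sum_subtractf_nat) auto
  also have "(\<Sum>L\<in>?Lp. (card L - 1) * M) = k * M"
    unfolding sum_lines_through[OF pV, symmetric] by (simp add: sum_distrib_right)
  finally have "(\<Sum>L\<in>?Lp. k - (card L - 1) * M) = 0" using card_lines_through[OF pV] by simp
  then have "k - (card L - 1) * M = 0" using assms p finite_lines by simp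
  then show 1: "(card L - 1) * M = k" using card_line_le(1)[OF assms] by simp
  then show "card L \<ge> 2" using mu_less by (cases "card L - 1") auto
qed

lemma card_nbrs_on_line:
  assumes "L \<in> lines" "x \<in> V" "x \<notin> L"
  shows "card {y\<in>L. E x y} * M = mu"
proof -
  have "card L * M = k + M" using card_line[OF assms(1)] by (metis Suc_diff_1 add.commute mult_Suc not_numeral_le_zero gr0I)
  then have "real (card L * M) = real (k + M)" by simp
  then have "real (card L) * m = real k + m" using m_M by simp
  from clique_tight[OF line_clique[OF assms(1)] card_line_le(2)[OF assms(1)] this assms(2,3)]
  have "real (card {y\<in>L. E x y} * M) = real mu" using m_M by simp
  then show ?thesis unfolding of_nat_eq_iff .
qed

end

section \<open>Partial geometries\<close>

text \<open>Reads off the eigenvalues of a graph with explicit parameters, as needed for the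
  intersection graph of lines.\<close>

lemma (in srg) eigenvalues_unique:
  assumes "x \<ge> 0" "y \<ge> 0" "x - y = real lam - real mu" "x * y = real k - real mu"
  shows "r = x" "m = y"
proof -
  have "(x + y)\<^sup>2 = (x - y)\<^sup>2 + 4 * (x * y)" by (simp add: power2_eq_square algebra_simps)
  then have "sqD = x + y" using assms by (simp add: sqD_def real_sqrt_unique)
  then show "r = x" "m = y" using assms(3) by (simp_all add: r_def m_def)
qed

text \<open>In the usual notation \<open>pg(s, t, alpha)\<close> these are \<open>n = s + 1\<close>,
  \<open>M = t + 1\<close> and \<open>a = alpha\<close>.\<close>

locale partial_geometry =
  fixes V :: "'a set" and lines :: "'a set set" and n M a :: nat
  assumes finV: "finite V" and V_ne: "V \<noteq> {}"
    and line_sub: "L \<in> lines \<Longrightarrow> L \<subseteq> V"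
    and card_line: "L \<in> lines \<Longrightarrow> card L = n"
    and pencil: "x \<in> V \<Longrightarrow> card {L\<in>lines. x \<in> L} = M"
    and line_unique: "\<lbrakk>L \<in> lines; L' \<in> lines; x \<in> L; y \<in> L; x \<in> L'; y \<in> L'; x \<noteq> y\<rbrakk> \<Longrightarrow> L = L'"
    and meeting: "\<lbrakk>x \<in> V; L \<in> lines; x \<notin> L\<rbrakk> \<Longrightarrow> card {L'\<in>lines. x \<in> L' \<and> L' \<inter> L \<noteq> {}} = a"
    and M_ge: "M \<ge> 2" and n_ge: "n \<ge> 2" and a_ge: "a \<ge> 1"
begin

lemma finite_lines: "finite lines"
  by (rule finite_subset[of _ "Pow V"]) (use line_sub finV in auto)

lemma finite_line: "L \<in> lines \<Longrightarrow> finite L"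
  using line_sub finV finite_subset by blast

lemma finite_pencil: "finite {L\<in>lines. P L}"
  using finite_lines by simp

lemma meet_eq: "\<lbrakk>L \<in> lines; L' \<in> lines; L \<noteq> L'; x \<in> L; x \<in> L'; y \<in> L; y \<in> L'\<rbrakk> \<Longrightarrow> x = y"
  using line_unique by blast

lemma line_not_subset:
  assumes "L \<in> lines" "L' \<in> lines" "L \<noteq> L'"
  obtains x where "x \<in> L'" "x \<notin> L"
proof -
  have "\<not> L' \<subseteq> L"
    using assms card_line card_subset_eq[OF finite_line[OF assms(1)], of L'] by auto
  then show ?thesis using that by blast
qed

lemma two_lines_through:
  assumes "x \<in> V"
  obtains L L' where "L \<in> lines" "L' \<in> lines" "x \<in> L" "x \<in> L'" "L \<noteq> L'"
proof -
  have "2 \<le> card {L\<in>lines. x \<in> L}" using pencil[OF assms] M_ge by simp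
  then obtain T where T: "T \<subseteq> {L\<in>lines. x \<in> L}" "card T = 2" by (metis obtain_subset_with_card_n)
  then obtain L L' where "T = {L, L'}" "L \<noteq> L'" by (auto simp: card_2_iff)
  then show ?thesis using that[of L L'] T by auto
qed

lemma non_incident_pair:
  obtains x L where "x \<in> V" "L \<in> lines" "x \<notin> L"
proof -
  obtain p where "p \<in> V" using V_ne by blast
  then obtain L L' where LL: "L \<in> lines" "L' \<in> lines" "L \<noteq> L'" using two_lines_through by metis
  then obtain x where "x \<in> L'" "x \<notin> L" using line_not_subset by metis
  then show ?thesis using that LL line_sub by blast
qed

lemma a_le_M: "a \<le> M"
proof -
  obtain x L where x: "x \<in> V" "L \<in> lines" "x \<notin> L" using non_incident_pair .
  have "card {L'\<in>lines. x \<in> L' \<and> L' \<inter> L \<noteq> {}} \<le> card {L'\<in>lines. x \<in> L'}"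
    using finite_pencil by (intro card_mono) auto
  then show ?thesis using meeting[OF x] pencil[OF x(1)] by simp
qed

definition meets :: "'a set \<Rightarrow> 'a set \<Rightarrow> bool" where
  "meets L L' \<longleftrightarrow> L \<in> lines \<and> L' \<in> lines \<and> L \<noteq> L' \<and> L \<inter> L' \<noteq> {}"

text \<open>Common neighbours of lines meeting in \<open>p\<close> are the \<open>M - 2\<close>
  further lines through \<open>p\<close> and, for each other point of \<open>L\<close>, the
  \<open>a\<close> lines that meet \<open>L'\<close> except \<open>L\<close> itself; for disjoint
  lines all \<open>n\<close> points contribute \<open>a\<close>. The assumption yields disjoint
  lines and \<open>n * a < n * (M - 1)\<close>.\<close>

lemma line_graph_srg:
  assumes aM: "a + 2 \<le> M"
  shows "srg lines meets (n * (M - 1)) ((n - 1) * (a - 1) + (M - 2)) (n * a)"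
proof
  show "finite lines" by (rule finite_lines)
  show "meets x y \<Longrightarrow> x \<in> lines \<and> y \<in> lines" for x y by (simp add: meets_def)
  show "meets x y \<Longrightarrow> meets y x" for x y by (auto simp: meets_def)
  show "\<not> meets x x" for x by (simp add: meets_def)
  show "card {K. meets L K} = n * (M - 1)" if L: "L \<in> lines" for L
  proof -
    have "{K. meets L K} = (\<Union>x\<in>L. {K\<in>lines. x \<in> K} - {L})" using L by (auto simp: meets_def)
    also have "card \<dots> = (\<Sum>x\<in>L. card ({K\<in>lines. x \<in> K} - {L}))"
      using finite_line[OF L] finite_pencil meet_eq[OF L] by (intro card_UN_disjoint) auto
    also have "\<dots> = (\<Sum>x\<in>L. M - 1)"
    proof (rule sum.cong[OF refl])
      fix x assume "x \<in> L"
      then show "card ({K\<in>lines. x \<in> K} - {L}) = M - 1"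
        using L pencil[of x] line_sub[OF L] by (subst card_Diff_singleton) auto
    qed
    finally show ?thesis using card_line[OF L] by simp
  qed
  show "card {K. meets L K \<and> meets L' K} = (n - 1) * (a - 1) + (M - 2)" if LL': "meets L L'" for L L'
  proof -
    have L: "L \<in> lines" "L' \<in> lines" "L \<noteq> L'" using LL' by (auto simp: meets_def)
    obtain p where p: "p \<in> L" "p \<in> L'" using LL' by (auto simp: meets_def)
    let ?P = "{K\<in>lines. p \<in> K} - {L, L'}"
    let ?F = "\<lambda>x. {K\<in>lines. x \<in> K \<and> K \<inter> L' \<noteq> {}} - {L}"
    have notin: "x \<notin> L'" if "x \<in> L - {p}" for x using that p meet_eq[OF L] by blast
    have eq: "{K. meets L K \<and> meets L' K} = ?P \<union> (\<Union>x\<in>L - {p}. ?F x)"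
      using L p notin by (auto simp: meets_def)
    have "card (?P \<union> (\<Union>x\<in>L - {p}. ?F x)) = card ?P + card (\<Union>x\<in>L - {p}. ?F x)"
      using finite_pencil finite_line[OF L(1)] meet_eq[OF L(1)] p by (intro card_Un_disjoint) auto
    also have "card ?P = M - 2"
      using L p pencil[of p] line_sub[OF L(1)] by (subst card_Diff_subset) auto
    also have "card (\<Union>x\<in>L - {p}. ?F x) = (\<Sum>x\<in>L - {p}. card (?F x))"
      using finite_line[OF L(1)] finite_pencil meet_eq[OF L(1)] by (intro card_UN_disjoint) auto
    also have "\<dots> = (\<Sum>x\<in>L - {p}. a - 1)"
    proof (rule sum.cong[OF refl])
      fix x assume x: "x \<in> L - {p}"
      then have "card {K\<in>lines. x \<in> K \<and> K \<inter> L' \<noteq> {}} = a"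
        using meeting[of x L'] notin[OF x] L line_sub by blast
      then show "card (?F x) = a - 1" using x L p by (subst card_Diff_singleton) auto
    qed
    also have "\<dots> = (n - 1) * (a - 1)" using card_line[OF L(1)] p by simp
    finally show ?thesis unfolding eq by simp
  qed
  show "card {K. meets L K \<and> meets L' K} = n * a"
    if L: "L \<in> lines" "L' \<in> lines" "L \<noteq> L'" and nm: "\<not> meets L L'" for L L'
  proof -
    let ?F = "\<lambda>x. {K\<in>lines. x \<in> K \<and> K \<inter> L' \<noteq> {}}"
    have disj: "L \<inter> L' = {}" using L nm by (auto simp: meets_def)
    have "{K. meets L K \<and> meets L' K} = (\<Union>x\<in>L. ?F x)"
      using L disj by (auto simp: meets_def)
    also have "card (\<Union>x\<in>L. ?F x) = (\<Sum>x\<in>L. card (?F x))"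
    proof (rule card_UN_disjoint[OF finite_line[OF L(1)]])
      show "\<forall>x\<in>L. finite (?F x)" using finite_pencil by auto
      show "\<forall>x\<in>L. \<forall>y\<in>L. x \<noteq> y \<longrightarrow> ?F x \<inter> ?F y = {}"
        using meet_eq[OF L(1)] disj by auto
    qed
    also have "\<dots> = (\<Sum>x\<in>L. a)"
      using meeting L disj line_sub by (intro sum.cong refl) blast
    finally show ?thesis using card_line[OF L(1)] by simp
  qed
  show "\<exists>x\<in>lines. \<exists>y\<in>lines. x \<noteq> y \<and> \<not> meets x y"
  proof -
    obtain x L where x: "x \<in> V" "L \<in> lines" "x \<notin> L" using non_incident_pair .
    have "{L'\<in>lines. x \<in> L' \<and> L' \<inter> L \<noteq> {}} \<noteq> {L'\<in>lines. x \<in> L'}"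
    proof
      assume eq: "{L'\<in>lines. x \<in> L' \<and> L' \<inter> L \<noteq> {}} = {L'\<in>lines. x \<in> L'}"
      have "a = M" using meeting[OF x] pencil[OF x(1)] unfolding eq by simp
      then show False using aM by simp
    qed
    then obtain L' where "L' \<in> lines" "x \<in> L'" "L' \<inter> L = {}" by blast
    then show ?thesis using x(2,3) by (intro bexI[of _ L'] bexI[of _ L]) (auto simp: meets_def)
  qed
  show "0 < n * a" using n_ge a_ge by simp
  show "n * a < n * (M - 1)" using n_ge aM by simp
qed

text \<open>The multiplicity \<open>g\<close> of the eigenvalue \<open>- n\<close> of the
  intersection graph is bounded in terms of \<open>M\<close> and \<open>a\<close>, while the number
  of lines grows linearly with \<open>n\<close>. The absolute bound therefore limits
  \<open>n\<close>.\<close>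

lemma line_size_bound:
  assumes aM: "a + 2 \<le> M"
  shows "n - 1 \<le> 2 * M ^ 4"
proof -
  interpret B: srg lines meets "n * (M - 1)" "(n - 1) * (a - 1) + (M - 2)" "n * a"
    by (rule line_graph_srg[OF aM])
  \<comment> \<open>Here \<open>t\<close> is \<open>M\<close> itself, not \<open>M - 1\<close> as in
    the usual notation.\<close>
  define s b t where "s = real n - 1" and "b = real a" and "t = real M"
  have pos: "s \<ge> 1" "b \<ge> 1" "t \<ge> b + 2" using n_ge a_ge aM by (auto simp: s_def b_def t_def)
  have B_k: "real (n * (M - 1)) = (s + 1) * (t - 1)" and B_mu: "real (n * a) = (s + 1) * b"
    and B_lam: "real ((n - 1) * (a - 1) + (M - 2)) = s * (b - 1) + (t - 2)"
    using n_ge a_ge M_ge by (simp_all add: s_def b_def t_def of_nat_diff)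
  have rm: "B.r = t - 1 - b" "B.m = s + 1"
  proof -
    have "t - 1 - b \<ge> 0" "s + 1 \<ge> 0" using pos by auto
    moreover have "(t - 1 - b) - (s + 1) = real ((n - 1) * (a - 1) + (M - 2)) - real (n * a)"
      unfolding B_mu B_lam by (simp add: algebra_simps)
    moreover have "(t - 1 - b) * (s + 1) = real (n * (M - 1)) - real (n * a)"
      unfolding B_mu B_k by (simp add: algebra_simps)
    ultimately show "B.r = t - 1 - b" "B.m = s + 1" by (rule B.eigenvalues_unique)+
  qed
  obtain g :: nat where g: "real g * (B.r + B.m) = (B.v - 1) * B.r + real (n * (M - 1))"
    "B.v - 1 \<le> 2 * (real g)\<^sup>2" using B.absolute_bound_m .
  have "(s + 1) * (b * (B.v - 1)) = (s + 1) * ((t - 1) * (t * s + b))"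
    using B.v_eq unfolding B_k B_mu rm by (simp add: algebra_simps)
  then have bv: "b * (B.v - 1) = (t - 1) * (t * s + b)" using pos by simp
  have gst: "real g * (s + t - b) = (B.v - 1) * (t - 1 - b) + (s + 1) * (t - 1)"
    using g(1) unfolding B_k rm by (simp add: algebra_simps)
  have "b * (real g * (s + t - b)) = (b * (B.v - 1)) * (t - 1 - b) + b * ((s + 1) * (t - 1))"
    unfolding gst by (simp add: algebra_simps)
  also have "\<dots> = (t - 1) * (t - b) * (s * (t - 1) + b)" unfolding bv by (simp add: algebra_simps)
  also have "\<dots> \<le> (t - 1) * (t - b) * ((t - 1) * (s + t - b))"
  proof (rule mult_left_mono)
    have "b \<le> t - 1" "t - 1 \<le> (t - 1) * (t - b)" using pos by (auto simp: mult_le_cancel_left1)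
    then have "b \<le> (t - 1) * (t - b)" by linarith
    then show "s * (t - 1) + b \<le> (t - 1) * (s + t - b)" by (simp add: algebra_simps)
    show "0 \<le> (t - 1) * (t - b)" using pos by simp
  qed
  finally have "(b * real g) * (s + t - b) \<le> ((t - 1)\<^sup>2 * (t - b)) * (s + t - b)"
    by (simp add: power2_eq_square mult_ac)
  then have bg: "b * real g \<le> (t - 1)\<^sup>2 * (t - b)" using pos by simp
  have "t * s * (t - 1) \<le> (t - 1) * (t * s + b)" using pos by (simp add: algebra_simps)
  then have "t * s * (t - 1) \<le> b * (B.v - 1)" using bv by simp
  \<comment> \<open>A second factor \<open>b\<close> is inserted so that \<open>g\<close> occurs
    only as \<open>b * g\<close>, to which \<open>bg\<close> applies.\<close>
  also have "\<dots> \<le> b * (b * (B.v - 1))"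
  proof -
    have "0 \<le> b * (B.v - 1)" unfolding bv using pos by simp
    then have "1 * (b * (B.v - 1)) \<le> b * (b * (B.v - 1))" using pos by (intro mult_right_mono) auto
    then show ?thesis by simp
  qed
  also have "\<dots> \<le> b * (b * (2 * (real g)\<^sup>2))" using g(2) pos by (intro mult_left_mono) auto
  also have "\<dots> = 2 * (b * real g)\<^sup>2" by (simp add: power2_eq_square)
  also have "\<dots> \<le> 2 * ((t - 1)\<^sup>2 * (t - b))\<^sup>2" using bg pos by (intro mult_left_mono power_mono) auto
  also have "\<dots> = (t - 1) * (2 * ((t - 1) ^ 3 * (t - b)\<^sup>2))"
    by (simp add: power_mult_distrib power2_eq_square power3_eq_cube mult_ac)
  finally have "(t - 1) * (t * s) \<le> (t - 1) * (2 * ((t - 1) ^ 3 * (t - b)\<^sup>2))" by (simp add: mult_ac)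
  then have "t * s \<le> 2 * ((t - 1) ^ 3 * (t - b)\<^sup>2)" using pos by simp
  also have "\<dots> \<le> 2 * (t ^ 3 * t\<^sup>2)" using pos by (intro mult_left_mono mult_mono power_mono) auto
  also have "\<dots> = t * (2 * t ^ 4)" by (simp add: eval_nat_numeral)
  finally have "s \<le> 2 * t ^ 4" using pos by simp
  then have "real (n - 1) \<le> real (2 * M ^ 4)" using n_ge by (simp add: s_def t_def of_nat_diff)
  then show ?thesis unfolding of_nat_le_iff .
qed

end

section \<open>Extreme values of \<open>a\<close>: dual Steiner systems and nets\<close>

context partial_geometry begin

definition collinear :: "'a \<Rightarrow> 'a \<Rightarrow> bool" where
  "collinear x y \<longleftrightarrow> (\<exists>L\<in>lines. x \<in> L \<and> y \<in> L)"

text \<open>If \<open>a = M\<close>, every line through a point off \<open>L\<close> meets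
  \<open>L\<close>, so any two lines share exactly one point. In the dual, lines are the points of
  the system (numbered by \<open>idx\<close>) and each point becomes the block of its lines.\<close>

lemma dual_steiner_system:
  assumes aM: "a = M"
  obtains X B and phi :: "'a \<Rightarrow> nat set"
  where "steiner_system X B M" "bij_betw phi V B"
    and "\<And>x y. x \<in> V \<Longrightarrow> y \<in> V \<Longrightarrow> collinear x y \<longleftrightarrow> phi x \<inter> phi y \<noteq> {}"
proof -
  obtain idx :: "'a set \<Rightarrow> nat" where idx: "inj_on idx lines"
    using finite_imp_inj_to_nat_seg[OF finite_lines] by blast
  define phi where "phi = (\<lambda>x. idx ` {L\<in>lines. x \<in> L})"
  have meet: "\<exists>x\<in>V. x \<in> L \<and> x \<in> L'" if L: "L \<in> lines" "L' \<in> lines" "L \<noteq> L'" for L L'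
  proof -
    obtain x where x: "x \<in> L'" "x \<notin> L" using line_not_subset[OF L] .
    then have xV: "x \<in> V" using L line_sub by blast
    have "{K\<in>lines. x \<in> K \<and> K \<inter> L \<noteq> {}} = {K\<in>lines. x \<in> K}"
      by (rule card_subset_eq[OF finite_pencil])
        (use meeting[OF xV L(1) x(2)] pencil[OF xV] aM in auto)
    then have "L' \<inter> L \<noteq> {}" using L x by blast
    then show ?thesis using L line_sub by blast
  qed
  have phi_iff: "idx L \<in> phi x \<longleftrightarrow> x \<in> L" if "L \<in> lines" for L x
    using that idx by (auto simp: phi_def inj_on_def)
  have "inj_on phi V"
  proof (rule inj_onI)
    fix x y assume xy: "x \<in> V" "y \<in> V" "phi x = phi y"
    obtain L L' where L: "L \<in> lines" "L' \<in> lines" "x \<in> L" "x \<in> L'" "L \<noteq> L'"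
      using two_lines_through[OF xy(1)] .
    then have "y \<in> L" "y \<in> L'" using phi_iff xy(3) by metis+
    then show "x = y" using meet_eq L by blast
  qed
  then have "bij_betw phi V (phi ` V)" by (simp add: bij_betw_def)
  moreover have "steiner_system (idx ` lines) (phi ` V) M"
    unfolding steiner_system_def
  proof (intro conjI ballI impI)
    show "finite (idx ` lines)" using finite_lines by simp
    fix b assume "b \<in> phi ` V"
    then obtain x where x: "x \<in> V" "b = phi x" by blast
    show "b \<subseteq> idx ` lines" using x by (auto simp: phi_def)
    have "card b = card {L\<in>lines. x \<in> L}"
      unfolding x(2) phi_def by (rule card_image) (use idx in \<open>auto simp: inj_on_def\<close>)
    then show "card b = M" using pencil[OF x(1)] by simp
  next
    fix p q assume pq: "p \<in> idx ` lines" "q \<in> idx ` lines" "p \<noteq> q"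
    then obtain L L' where L: "L \<in> lines" "L' \<in> lines" "p = idx L" "q = idx L'" "L \<noteq> L'" by blast
    then obtain x where x: "x \<in> V" "x \<in> L" "x \<in> L'" using meet by blast
    show "\<exists>!b. b \<in> phi ` V \<and> p \<in> b \<and> q \<in> b"
    proof (rule ex1I[of _ "phi x"])
      show "phi x \<in> phi ` V \<and> p \<in> phi x \<and> q \<in> phi x" using x L phi_iff by auto
      fix b assume "b \<in> phi ` V \<and> p \<in> b \<and> q \<in> b"
      then obtain y where y: "y \<in> V" "b = phi y" "p \<in> phi y" "q \<in> phi y" by blast
      then have "y \<in> L" "y \<in> L'" using L phi_iff by auto
      then have "y = x" using meet_eq L x by blast
      then show "b = phi x" using y by simp
    qed
  qed
  moreover have "collinear x y \<longleftrightarrow> phi x \<inter> phi y \<noteq> {}" for x y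
  proof
    assume "collinear x y"
    then obtain L where "L \<in> lines" "x \<in> L" "y \<in> L" by (auto simp: collinear_def)
    then show "phi x \<inter> phi y \<noteq> {}" using phi_iff by blast
  next
    assume "phi x \<inter> phi y \<noteq> {}"
    then obtain L where "L \<in> lines" "x \<in> L" "idx L \<in> phi y" by (auto simp: phi_def)
    then show "collinear x y" using phi_iff by (auto simp: collinear_def)
  qed
  ultimately show ?thesis using that by blast
qed

definition parallel :: "'a set \<Rightarrow> 'a set \<Rightarrow> bool" where
  "parallel L L' \<longleftrightarrow> L = L' \<or> L \<inter> L' = {}"

text \<open>Of the \<open>M\<close> lines through a point off \<open>L\<close>, all but
  \<open>M - a = 1\<close> meet \<open>L\<close>.\<close>

lemma parallel_unique:
  assumes aM: "a + 1 = M" and x: "x \<in> V" and L: "L \<in> lines"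
  shows "\<exists>!K. K \<in> lines \<and> x \<in> K \<and> parallel K L"
proof (cases "x \<in> L")
  case True
  then show ?thesis using L by (auto simp: parallel_def)
next
  case False
  let ?S = "{K\<in>lines. x \<in> K}" and ?T = "{K\<in>lines. x \<in> K \<and> K \<inter> L \<noteq> {}}"
  have "card (?S - ?T) = card ?S - card ?T" using finite_pencil by (intro card_Diff_subset) auto
  also have "\<dots> = 1" using pencil[OF x] meeting[OF x L False] aM by simp
  finally obtain K where "?S - ?T = {K}" by (auto simp: card_1_singleton_iff)
  then have "\<And>J. J \<in> lines \<and> x \<in> J \<and> J \<inter> L = {} \<longleftrightarrow> J = K" by blast
  then have "\<And>J. J \<in> lines \<and> x \<in> J \<and> parallel J L \<longleftrightarrow> J = K"
    using False unfolding parallel_def by blast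
  then show ?thesis by simp
qed

lemma parallel_sym: "parallel L L' \<Longrightarrow> parallel L' L"
  by (auto simp: parallel_def)

lemma parallel_trans:
  assumes aM: "a + 1 = M" and "K \<in> lines" "L \<in> lines" "J \<in> lines" "parallel K L" "parallel L J"
  shows "parallel K J"
proof (rule ccontr)
  assume n: "\<not> parallel K J"
  then obtain x where x: "x \<in> K" "x \<in> J" "K \<noteq> J" by (auto simp: parallel_def)
  have "x \<in> V" using x line_sub assms by blast
  from parallel_unique[OF aM this assms(3)] have "K = J" using assms x parallel_sym by blast
  with x show False by simp
qed

text \<open>The geometry is a net: the \<open>M\<close> lines through a fixed point \<open>p\<close>
  represent its parallel classes \<open>C i\<close>, and \<open>e i x\<close> numbers the line of
  class \<open>i\<close> through \<open>x\<close>. Lines of different classes meet in exactly one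
  point, so any two classes coordinatise the points.\<close>

lemma orthogonal_array:
  assumes aM: "a + 1 = M"
  obtains e :: "nat \<Rightarrow> 'a \<Rightarrow> nat" where
    "\<And>i j. i < M \<Longrightarrow> j < M \<Longrightarrow> i \<noteq> j \<Longrightarrow> bij_betw (\<lambda>x. (e i x, e j x)) V ({0..<n} \<times> {0..<n})"
    and "\<And>x y. x \<in> V \<Longrightarrow> y \<in> V \<Longrightarrow> collinear x y \<longleftrightarrow> (\<exists>i<M. e i x = e i y)"
proof -
  obtain p where p: "p \<in> V" using V_ne by blast
  obtain l where l: "bij_betw l {0..<M} {L\<in>lines. p \<in> L}"
    using ex_bij_betw_nat_finite[OF finite_pencil] pencil[OF p] by metis
  have l_line: "l i \<in> lines" "p \<in> l i" if "i < M" for i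
    using bij_betwE[OF l] that by auto
  have l_par: "i = j" if "i < M" "j < M" "parallel (l i) (l j)" for i j
  proof -
    have "l i = l j" using that l_line[of i] l_line[of j] by (auto simp: parallel_def)
    then show ?thesis using l that by (auto simp: bij_betw_def inj_on_def)
  qed
  define C where "C = (\<lambda>i. {L\<in>lines. parallel L (l i)})"
  define f where "f = (\<lambda>i x. THE K. K \<in> lines \<and> x \<in> K \<and> parallel K (l i))"
  have f: "f i x \<in> lines \<and> x \<in> f i x \<and> parallel (f i x) (l i)" if "i < M" "x \<in> V" for i x
    unfolding f_def by (rule theI'[OF parallel_unique[OF aM that(2) l_line(1)[OF that(1)]]])
  have f_eq: "f i x = K" if "i < M" "x \<in> V" "K \<in> C i" "x \<in> K" for i x K
    using parallel_unique[OF aM that(2) l_line(1)[OF that(1)]] f[OF that(1,2)] that(3,4)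
    unfolding C_def by blast
  have fC: "f i x \<in> C i" if "i < M" "x \<in> V" for i x using f[OF that] by (simp add: C_def)
  have C_diff: "K \<noteq> K' \<and> K \<inter> K' \<noteq> {}" if "i < M" "j < M" "i \<noteq> j" "K \<in> C i" "K' \<in> C j" for i j K K'
  proof (rule ccontr)
    assume "\<not> ?thesis"
    then have "parallel K K'" by (auto simp: parallel_def)
    moreover have K: "K \<in> lines" "K' \<in> lines" "parallel (l i) K" "parallel K' (l j)"
      using that parallel_sym by (auto simp: C_def)
    ultimately have "parallel (l i) K'"
      using parallel_trans[OF aM l_line(1)[OF that(1)] K(1,2)] by blast
    then have "parallel (l i) (l j)"
      using parallel_trans[OF aM l_line(1)[OF that(1)] K(2) l_line(1)[OF that(2)]] K by blast
    then show False using l_par that by blast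
  qed
  have f_inj: "x = y" if "i < M" "j < M" "i \<noteq> j" "x \<in> V" "y \<in> V" "f i x = f i y" "f j x = f j y" for i j x y
    using meet_eq[of "f i x" "f j x" x y] f[of i x] f[of j x] f[of i y] f[of j y] that
      C_diff[OF that(1,2,3) fC[OF that(1,4)] fC[OF that(2,4)]] by simp
  have f_surj: "\<exists>x\<in>V. f i x = K \<and> f j x = K'" if ij: "i < M" "j < M" "i \<noteq> j" "K \<in> C i" "K' \<in> C j" for i j K K'
  proof -
    obtain x where x: "x \<in> K" "x \<in> K'" using C_diff[OF ij] by blast
    moreover have "x \<in> V" using x ij line_sub by (auto simp: C_def)
    ultimately show ?thesis using f_eq ij by blast
  qed
  have card_C: "card (C i) = n" if i: "i < M" for i
  proof -
    \<comment> \<open>Each line of class \<open>i\<close> meets the line \<open>l j\<close> of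
      another class in one point, so the class has as many lines as \<open>l j\<close> has
      points.\<close>
    have "(if i = 0 then 1 else 0) < M \<and> (if i = 0 then 1 else 0) \<noteq> i" using M_ge by simp
    then obtain j where j: "j < M" "j \<noteq> i" by blast
    have ljC: "l j \<in> C j" using l_line[OF j(1)] by (simp add: C_def parallel_def)
    have ljV: "l j \<subseteq> V" using l_line[OF j(1)] line_sub by blast
    have "bij_betw (f i) (l j) (C i)"
      unfolding bij_betw_def
    proof
      show "inj_on (f i) (l j)"
      proof (rule inj_onI)
        fix x y assume xy: "x \<in> l j" "y \<in> l j" "f i x = f i y"
        then show "x = y"
          using f_inj[of i j x y] f_eq[OF j(1) _ ljC] ljV i j by auto
      qed
      show "f i ` l j = C i"
      proof
        show "f i ` l j \<subseteq> C i" using fC[OF i] ljV by blast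
        show "C i \<subseteq> f i ` l j"
        proof
          fix K assume K: "K \<in> C i"
          then obtain x where x: "x \<in> V" "f i x = K" "f j x = l j" using f_surj[OF i j(1)] j ljC by metis
          then have "x \<in> l j" using f[OF j(1) x(1)] by simp
          then show "K \<in> f i ` l j" using x by blast
        qed
      qed
    qed
    then show ?thesis using bij_betw_same_card card_line l_line[OF j(1)] by metis
  qed
  have "\<exists>g. bij_betw g (C i) {0..<n}" if "i < M" for i
    using ex_bij_betw_finite_nat[of "C i"] card_C[OF that] finite_lines by (auto simp: C_def)
  then obtain g where g: "\<And>i. i < M \<Longrightarrow> bij_betw (g i) (C i) {0..<n}" by metis
  define e where "e = (\<lambda>i x. g i (f i x))"
  have e_iff: "e i x = e i y \<longleftrightarrow> f i x = f i y" if "i < M" "x \<in> V" "y \<in> V" for i x y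
    using inj_on_eq_iff[OF bij_betw_imp_inj_on[OF g[OF that(1)]] fC[OF that(1,2)] fC[OF that(1,3)]]
    by (simp add: e_def)
  have "bij_betw (\<lambda>x. (e i x, e j x)) V ({0..<n} \<times> {0..<n})" if ij: "i < M" "j < M" "i \<noteq> j" for i j
    unfolding bij_betw_def
  proof
    show "inj_on (\<lambda>x. (e i x, e j x)) V"
      by (rule inj_onI) (use e_iff f_inj[OF ij] ij in auto)
    show "(\<lambda>x. (e i x, e j x)) ` V = {0..<n} \<times> {0..<n}"
    proof
      show "(\<lambda>x. (e i x, e j x)) ` V \<subseteq> {0..<n} \<times> {0..<n}"
        using bij_betwE[OF g[OF ij(1)]] bij_betwE[OF g[OF ij(2)]] fC ij by (auto simp: e_def)
      show "{0..<n} \<times> {0..<n} \<subseteq> (\<lambda>x. (e i x, e j x)) ` V"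
      proof
        fix c assume "c \<in> {0..<n} \<times> {0..<n}"
        then obtain u w where c: "c = (u, w)" "u \<in> {0..<n}" "w \<in> {0..<n}" by blast
        then obtain K K' where K: "K \<in> C i" "K' \<in> C j" "g i K = u" "g j K' = w"
          using g[OF ij(1)] g[OF ij(2)] unfolding bij_betw_def by (metis imageE)
        then obtain x where "x \<in> V" "f i x = K" "f j x = K'" using f_surj[OF ij] by blast
        then show "c \<in> (\<lambda>x. (e i x, e j x)) ` V" using c K by (auto simp: e_def)
      qed
    qed
  qed
  moreover have "collinear x y \<longleftrightarrow> (\<exists>i<M. e i x = e i y)" if xy: "x \<in> V" "y \<in> V" for x y
  proof
    assume "collinear x y"
    then obtain L where L: "L \<in> lines" "x \<in> L" "y \<in> L" by (auto simp: collinear_def)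
    obtain K where K: "K \<in> lines" "p \<in> K" "parallel K L" using parallel_unique[OF aM p L(1)] by blast
    have "K \<in> l ` {0..<M}" using K(1,2) bij_betw_imp_surj_on[OF l] by simp
    then obtain i where i: "i < M" "K = l i" by auto
    then have "L \<in> C i" using L i parallel_sym[OF K(3)] by (simp add: C_def)
    then have "f i x = f i y" using f_eq[OF i(1)] xy L by simp
    then show "\<exists>i<M. e i x = e i y" using i e_iff xy by blast
  next
    assume "\<exists>i<M. e i x = e i y"
    then obtain i where i: "i < M" "f i x = f i y" using e_iff xy by blast
    then show "collinear x y" using f[OF i(1) xy(1)] f[OF i(1) xy(2)] by (auto simp: collinear_def)
  qed
  ultimately show ?thesis using that by blast
qed

lemma steiner_graph_points:
  fixes E :: "nat \<Rightarrow> nat \<Rightarrow> bool"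
  assumes "a = M" and h: "bij_betw h {0..<w} V"
    and E: "\<And>x y. x < w \<Longrightarrow> y < w \<Longrightarrow> E x y \<longleftrightarrow> x \<noteq> y \<and> collinear (h x) (h y)"
  shows "steiner_graph w E"
proof -
  obtain X B phi where S: "steiner_system X B M" "bij_betw phi V B"
    "\<And>x y. x \<in> V \<Longrightarrow> y \<in> V \<Longrightarrow> collinear x y \<longleftrightarrow> phi x \<inter> phi y \<noteq> {}"
    using dual_steiner_system[OF assms(1)] by blast
  have "bij_betw (phi \<circ> h) {0..<w} B" using bij_betw_trans[OF h S(2)] .
  moreover have "h x \<in> V" if "x < w" for x using bij_betwE[OF h] that by simp
  ultimately show ?thesis
    unfolding steiner_graph_def using S(1,3) E M_ge
    by (intro exI[of _ X] exI[of _ B] exI[of _ M] exI[of _ "phi \<circ> h"]) auto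
qed

text \<open>Coordinates 0 and 1 of the net become row and column; coordinate \<open>b + 2\<close>,
  read as a function of these two, is the square with index \<open>b\<close>.\<close>

lemma latin_square_graph_points:
  fixes E :: "nat \<Rightarrow> nat \<Rightarrow> bool"
  assumes "a + 1 = M" and h: "bij_betw h {0..<w} V"
    and E: "\<And>x y. x < w \<Longrightarrow> y < w \<Longrightarrow> E x y \<longleftrightarrow> x \<noteq> y \<and> collinear (h x) (h y)"
  shows "latin_square_graph w E"
proof -
  obtain e where e: "\<And>i j. i < M \<Longrightarrow> j < M \<Longrightarrow> i \<noteq> j \<Longrightarrow>
      bij_betw (\<lambda>x. (e i x, e j x)) V ({0..<n} \<times> {0..<n})"
    and col: "\<And>x y. x \<in> V \<Longrightarrow> y \<in> V \<Longrightarrow> collinear x y \<longleftrightarrow> (\<exists>i<M. e i x = e i y)"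
    using orthogonal_array[OF assms(1)] by blast
  define phi where "phi = (\<lambda>x. (e 0 x, e 1 x))"
  have phi: "bij_betw phi V ({0..<n} \<times> {0..<n})" unfolding phi_def using e[of 0 1] M_ge by simp
  define psi where "psi = inv_into V phi"
  have psi: "bij_betw psi ({0..<n} \<times> {0..<n}) V" unfolding psi_def by (rule bij_betw_inv_into[OF phi])
  have psi_V: "psi (i, j) \<in> V" if "i < n" "j < n" for i j using bij_betwE[OF psi] that by auto
  have e_psi: "e 0 (psi (i, j)) = i" "e 1 (psi (i, j)) = j" if "i < n" "j < n" for i j
    using bij_betw_inv_into_right[OF phi, of "(i, j)"] that by (auto simp: psi_def phi_def)
  have psi_phi: "psi (phi x) = x" if "x \<in> V" for x
    using bij_betw_inv_into_left[OF phi that] by (simp add: psi_def)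
  have e_lt: "e i x < n" if "i < M" "x \<in> V" for i x
  proof -
    have "(if i = 0 then 1 else 0) < M \<and> i \<noteq> (if i = 0 then 1 else 0)" using M_ge by simp
    then obtain j where "j < M" "i \<noteq> j" by blast
    then show ?thesis using bij_betwE[OF e[OF that(1)]] that(2) by force
  qed
  have e_inj: "x = y" if "i < M" "j < M" "i \<noteq> j" "x \<in> V" "y \<in> V" "e i x = e i y" "e j x = e j y" for i j x y
    using e[OF that(1,2,3)] that(4-) by (auto simp: bij_betw_def inj_on_def)
  define L where "L = (\<lambda>b c. e (b + 2) (psi c))"
  have "latin_square n (L b)" if b: "b < M - 2" for b
  proof -
    have bM: "b + 2 < M" using b by simp
    have "bij_betw (\<lambda>j. L b (i, j)) {0..<n} {0..<n}" if i: "i < n" for i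
    proof -
      have "inj_on (\<lambda>j. L b (i, j)) {0..<n}"
      proof (rule inj_onI)
        fix j j' assume j: "j \<in> {0..<n}" "j' \<in> {0..<n}" "L b (i, j) = L b (i, j')"
        then have "psi (i, j) = psi (i, j')"
          using e_inj[OF bM, of 0 "psi (i, j)" "psi (i, j')"] e_psi psi_V i M_ge by (simp add: L_def)
        then show "j = j'" using e_psi(2) i j by (metis atLeastLessThan_iff)
      qed
      moreover have "(\<lambda>j. L b (i, j)) ` {0..<n} \<subseteq> {0..<n}"
        using e_lt[OF bM] psi_V i by (auto simp: L_def)
      ultimately show ?thesis by (simp add: bij_betw_def endo_inj_surj)
    qed
    moreover have "bij_betw (\<lambda>i. L b (i, j)) {0..<n} {0..<n}" if j: "j < n" for j
    proof -
      have "inj_on (\<lambda>i. L b (i, j)) {0..<n}"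
      proof (rule inj_onI)
        fix i i' assume i: "i \<in> {0..<n}" "i' \<in> {0..<n}" "L b (i, j) = L b (i', j)"
        then have "psi (i, j) = psi (i', j)"
          using e_inj[OF bM, of 1 "psi (i, j)" "psi (i', j)"] e_psi psi_V j M_ge by (simp add: L_def)
        then show "i = i'" using e_psi(1) i j by (metis atLeastLessThan_iff)
      qed
      moreover have "(\<lambda>i. L b (i, j)) ` {0..<n} \<subseteq> {0..<n}"
        using e_lt[OF bM] psi_V j by (auto simp: L_def)
      ultimately show ?thesis by (simp add: bij_betw_def endo_inj_surj)
    qed
    ultimately show ?thesis by (simp add: latin_square_def)
  qed
  moreover have "orthogonal_squares n (L b) (L c)" if "b < M - 2" "c < M - 2" "b \<noteq> c" for b c
  proof -
    have "bij_betw ((\<lambda>x. (e (b + 2) x, e (c + 2) x)) \<circ> psi) ({0..<n} \<times> {0..<n}) ({0..<n} \<times> {0..<n})"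
      by (rule bij_betw_trans[OF psi e]) (use that in auto)
    then show ?thesis by (simp add: orthogonal_squares_def L_def o_def)
  qed
  moreover have "bij_betw (phi \<circ> h) {0..<w} ({0..<n} \<times> {0..<n})" by (rule bij_betw_trans[OF h phi])
  moreover have "E x y \<longleftrightarrow> x \<noteq> y \<and> (fst ((phi \<circ> h) x) = fst ((phi \<circ> h) y) \<or> snd ((phi \<circ> h) x) = snd ((phi \<circ> h) y) \<or>
      (\<exists>b<M - 2. L b ((phi \<circ> h) x) = L b ((phi \<circ> h) y)))" if xy: "x < w" "y < w" for x y
  proof -
    have V: "h x \<in> V" "h y \<in> V" using bij_betwE[OF h] xy by auto
    have "(\<exists>i<M. e i (h x) = e i (h y)) \<longleftrightarrow> e 0 (h x) = e 0 (h y) \<or> e 1 (h x) = e 1 (h y) \<or>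
        (\<exists>b<M - 2. e (b + 2) (h x) = e (b + 2) (h y))" (is "?l \<longleftrightarrow> ?r")
    proof
      assume ?l
      then obtain i where i: "i < M" "e i (h x) = e i (h y)" by blast
      consider "i = 0" | "i = 1" | b where "i = b + 2" by (metis One_nat_def add_2_eq_Suc' not0_implies_Suc)
      then show ?r using i by cases auto
    next
      assume ?r
      then show ?l using M_ge by (metis Suc_1 Suc_le_eq less_diff_conv less_trans One_nat_def lessI)
    qed
    then show ?thesis using E[OF xy] col[OF V] V psi_phi by (simp add: phi_def L_def)
  qed
  ultimately show ?thesis
    unfolding latin_square_graph_def using M_ge
    by (intro exI[of _ n] exI[of _ M] exI[of _ L] exI[of _ "phi \<circ> h"]) blast
qed

end

section \<open>The large cliques as lines of a partial geometry\<close>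

context claw_srg begin

lemma partial_geometry_lines:
  obtains n a where "partial_geometry V lines n M a" "R \<le> n - 1"
proof -
  obtain x where xV: "x \<in> V" using not_complete by blast
  \<comment> \<open>Both divisions are exact, by \<open>card_line\<close> and
    \<open>card_nbrs_on_line\<close>.\<close>
  define n where "n = k div M + 1"
  define a where "a = mu div M"
  have kn: "card L = n" if "L \<in> lines" for L
    using card_line[OF that] M_ge by (auto simp: n_def)
  have nb: "card {y\<in>L. E x y} = a" if "L \<in> lines" "x \<in> V" "x \<notin> L" for L x
    using card_nbrs_on_line[OF that] M_ge by (auto simp: a_def)
  have ex: "\<exists>L\<in>lines. \<exists>y\<in>V. y \<notin> L"
  proof -
    obtain u w where "u \<in> V" "w \<in> V" "u \<noteq> w" "\<not> E u w" using not_complete by blast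
    have "card {L\<in>lines. u \<in> L} \<noteq> 0" using card_lines_through[OF \<open>u \<in> V\<close>] M_ge by simp
    then have "{L\<in>lines. u \<in> L} \<noteq> {}" by (metis card.empty)
    then obtain L where "L \<in> lines" "u \<in> L" by blast
    then have "w \<notin> L" using line_clique[of L] \<open>u \<noteq> w\<close> \<open>\<not> E u w\<close> by (auto simp: clique_def)
    then show ?thesis using \<open>L \<in> lines\<close> \<open>w \<in> V\<close> by blast
  qed
  have "partial_geometry V lines n M a"
  proof
    show "finite V" by (rule finV)
    show "V \<noteq> {}" using xV by blast
    show "L \<in> lines \<Longrightarrow> L \<subseteq> V" for L using line_clique by (auto simp: clique_def)
    show "L \<in> lines \<Longrightarrow> card L = n" for L by (rule kn)
    show "x \<in> V \<Longrightarrow> card {L\<in>lines. x \<in> L} = M" for x by (rule card_lines_through)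
    show "L = L'" if "L \<in> lines" "L' \<in> lines" "x \<in> L" "y \<in> L" "x \<in> L'" "y \<in> L'" "x \<noteq> y" for L L' x y
      by (rule line_unique) (use that in auto)
    show "M \<ge> 2" by (rule M_ge)
    show "n \<ge> 2" using ex card_line(2) kn by auto
    show "a \<ge> 1" using ex card_nbrs_on_line nb mu_pos by (metis One_nat_def Suc_leI gr0I mult_is_0 nat_less_le)
    show "card {L'\<in>lines. x \<in> L' \<and> L' \<inter> L \<noteq> {}} = a" if x: "x \<in> V" "L \<in> lines" "x \<notin> L" for x L
    proof -
      \<comment> \<open>Joining \<open>x\<close> to its neighbours on \<open>L\<close> turns the
        number of neighbours into the number of lines through \<open>x\<close> that meet
        \<open>L\<close>.\<close>
      let ?j = "\<lambda>y. THE L'. L' \<in> lines \<and> x \<in> L' \<and> y \<in> L'"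
      have j: "?j y \<in> lines \<and> x \<in> ?j y \<and> y \<in> ?j y" if xy: "E x y" for y
      proof (rule theI')
        obtain L' where "L' \<in> lines" "x \<in> L'" "y \<in> L'" using line_through_edge[OF xy] .
        moreover have "x \<noteq> y" using xy irrefl by blast
        ultimately show "\<exists>!L'. L' \<in> lines \<and> x \<in> L' \<and> y \<in> L'"
          using line_unique by (intro ex1I[of _ L']) blast+
      qed
      have "bij_betw ?j {y\<in>L. E x y} {L'\<in>lines. x \<in> L' \<and> L' \<inter> L \<noteq> {}}"
        unfolding bij_betw_def
      proof
        show "inj_on ?j {y\<in>L. E x y}"
        proof (rule inj_onI)
          fix y z assume yz: "y \<in> {y\<in>L. E x y}" "z \<in> {y\<in>L. E x y}" "?j y = ?j z"
          show "y = z"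
          proof (rule ccontr)
            assume "y \<noteq> z"
            moreover have "?j y \<in> lines" "x \<in> ?j y" "y \<in> ?j y" "z \<in> ?j y"
              using j[of y] j[of z] yz by auto
            ultimately have "?j y = L" using line_unique[of "?j y" L y z] x yz by blast
            then show False using \<open>x \<in> ?j y\<close> x by simp
          qed
        qed
        show "?j ` {y\<in>L. E x y} = {L'\<in>lines. x \<in> L' \<and> L' \<inter> L \<noteq> {}}"
        proof
          show "?j ` {y\<in>L. E x y} \<subseteq> {L'\<in>lines. x \<in> L' \<and> L' \<inter> L \<noteq> {}}" using j by blast
          show "{L'\<in>lines. x \<in> L' \<and> L' \<inter> L \<noteq> {}} \<subseteq> ?j ` {y\<in>L. E x y}"
          proof
            fix L' assume "L' \<in> {L'\<in>lines. x \<in> L' \<and> L' \<inter> L \<noteq> {}}"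
            then obtain y where y: "L' \<in> lines" "x \<in> L'" "y \<in> L'" "y \<in> L" by blast
            then have xy: "x \<noteq> y" using x by blast
            then have "E x y" using line_clique[OF y(1)] y by (auto simp: clique_def)
            moreover have "?j y = L'" using j[OF \<open>E x y\<close>] y xy line_unique[of "?j y" L' x y] by blast
            ultimately show "L' \<in> ?j ` {y\<in>L. E x y}" using y by blast
          qed
        qed
      qed
      from bij_betw_same_card[OF this] show ?thesis using nb[OF x(2,1,3)] by simp
    qed
  qed
  moreover have "R \<le> n - 1"
  proof -
    have "k div M \<ge> (R * M) div M" unfolding k_nat by (intro div_le_mono) simp
    then show ?thesis using M_ge by (simp add: n_def)
  qed
  ultimately show ?thesis using that by blast
qed

lemma edge_iff_collinear:
  "E x y \<longleftrightarrow> x \<noteq> y \<and> (\<exists>L\<in>lines. x \<in> L \<and> y \<in> L)"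
proof
  assume "E x y"
  then show "x \<noteq> y \<and> (\<exists>L\<in>lines. x \<in> L \<and> y \<in> L)" using line_through_edge irrefl by metis
next
  assume "x \<noteq> y \<and> (\<exists>L\<in>lines. x \<in> L \<and> y \<in> L)"
  then show "E x y" using line_clique by (auto simp: clique_def)
qed

end

lemma claw_srg_geometric:
  assumes "claw_srg {0..<w} E k lam mu M R"
  shows "steiner_graph w E \<or> latin_square_graph w E"
proof -
  interpret claw_srg "{0..<w}" E k lam mu M R by fact
  obtain n a where pg: "partial_geometry {0..<w} lines n M a" and R: "R \<le> n - 1"
    using partial_geometry_lines .
  interpret G: partial_geometry "{0..<w}" lines n M a by (rule pg)
  have E: "E x y \<longleftrightarrow> x \<noteq> y \<and> G.collinear (id x) (id y)" for x y
    using edge_iff_collinear by (simp add: G.collinear_def)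
  \<comment> \<open>Otherwise
    \<open>R \<le> n - 1 \<le> 2 * M ^ 4 < 31 * M ^ 4 \<le> R\<close>.\<close>
  have "\<not> a + 2 \<le> M"
  proof
    assume "a + 2 \<le> M"
    then have "n - 1 \<le> 2 * M ^ 4" by (rule G.line_size_bound)
    moreover have "M ^ 4 > 0" using M_ge by simp
    ultimately show False using R R_M by linarith
  qed
  then have "a = M \<or> a + 1 = M" using G.a_le_M by linarith
  then show ?thesis
    using G.steiner_graph_points[of id w E] G.latin_square_graph_points[of id w E] E
    by (auto simp: bij_betw_id_iff)
qed

section \<open>The spectrum of the adjacency matrix\<close>

text \<open>Conjugation by the matrix whose first column is constant splits off the eigenvalue \<open>k\<close>.\<close>
lemma char_poly_constant_row_sum:
  fixes B :: "nat \<Rightarrow> nat \<Rightarrow> 'a :: field"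
  assumes row: "\<And>i. i < Suc n \<Longrightarrow> (\<Sum>j<Suc n. B i j) = k"
  shows "char_poly (mat (Suc n) (Suc n) (\<lambda>(i, j). B i j))
    = [:- k, 1:] * char_poly (mat n n (\<lambda>(i, j). B (Suc i) (Suc j) - B 0 (Suc j)))"
proof -
  let ?N = "Suc n"
  define A where "A = mat ?N ?N (\<lambda>(i, j). B i j)"
  define P :: "'a mat" where "P = mat ?N ?N (\<lambda>(i, j). if i = j \<or> j = 0 then 1 else 0)"
  define Q :: "'a mat" where "Q = mat ?N ?N (\<lambda>(i, j). if i = j then 1 else if j = 0 then - 1 else 0)"
  define D where "D = mat n n (\<lambda>(i, j). B (Suc i) (Suc j) - B 0 (Suc j))"
  define K where "K = mat 1 1 (\<lambda>_. k)"
  define H where "H = mat 1 n (\<lambda>(i, j). B 0 (Suc j))"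
  define F where "F = four_block_mat K H (0\<^sub>m n 1) D"
  have carr: "A \<in> carrier_mat ?N ?N" "P \<in> carrier_mat ?N ?N" "Q \<in> carrier_mat ?N ?N"
    "D \<in> carrier_mat n n" "K \<in> carrier_mat 1 1" "H \<in> carrier_mat 1 n" "F \<in> carrier_mat ?N ?N"
    by (auto simp: A_def P_def Q_def D_def K_def H_def F_def)
  have F_entry: "F $$ (i, j) = (if j = 0 then (if i = 0 then k else 0)
      else if i = 0 then B 0 j else B i j - B 0 j)" if "i < ?N" "j < ?N" for i j
    using that carr by (cases i; cases j) (auto simp: F_def K_def H_def D_def)
  have mult_entry: "(X * Y) $$ (i, j) = (\<Sum>l<?N. X $$ (i, l) * Y $$ (l, j))"
    if "X \<in> carrier_mat ?N ?N" "Y \<in> carrier_mat ?N ?N" "i < ?N" "j < ?N" for X Y :: "'a mat" and i j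
    using that by (simp add: scalar_prod_def atLeast0LessThan)
  have P_left: "(P * Y) $$ (i, j) = (if i = 0 then 0 else Y $$ (0, j)) + Y $$ (i, j)"
    if "Y \<in> carrier_mat ?N ?N" "i < ?N" "j < ?N" for Y i j
  proof -
    have "(P * Y) $$ (i, j) = (\<Sum>l<?N. (if l = 0 then (if i = 0 then 0 else Y $$ (0, j)) else 0)
        + (if l = i then Y $$ (i, j) else 0))"
      unfolding mult_entry[OF carr(2) that] using that by (intro sum.cong) (auto simp: P_def)
    then show ?thesis using that by (simp add: sum.distrib del: sum.lessThan_Suc)
  qed
  have Q_left: "(Q * Y) $$ (i, j) = Y $$ (i, j) - (if i = 0 then 0 else Y $$ (0, j))"
    if "Y \<in> carrier_mat ?N ?N" "i < ?N" "j < ?N" for Y i j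
  proof -
    have "(Q * Y) $$ (i, j) = (\<Sum>l<?N. (if l = 0 then (if i = 0 then 0 else - Y $$ (0, j)) else 0)
        + (if l = i then Y $$ (i, j) else 0))"
      unfolding mult_entry[OF carr(3) that] using that by (intro sum.cong) (auto simp: Q_def)
    then show ?thesis using that by (simp add: sum.distrib del: sum.lessThan_Suc)
  qed
  have PQ: "P * Q = 1\<^sub>m ?N"
  proof (rule eq_matI)
    fix i j assume "i < dim_row (1\<^sub>m ?N :: 'a mat)" "j < dim_col (1\<^sub>m ?N :: 'a mat)"
    then have ij: "i < ?N" "j < ?N" by auto
    show "(P * Q) $$ (i, j) = 1\<^sub>m ?N $$ (i, j)"
      unfolding P_left[OF carr(3) ij] using ij by (auto simp: Q_def)
  qed (use carr in auto)
  have QP: "Q * P = 1\<^sub>m ?N"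
  proof (rule eq_matI)
    fix i j assume "i < dim_row (1\<^sub>m ?N :: 'a mat)" "j < dim_col (1\<^sub>m ?N :: 'a mat)"
    then have ij: "i < ?N" "j < ?N" by auto
    show "(Q * P) $$ (i, j) = 1\<^sub>m ?N $$ (i, j)"
      unfolding Q_left[OF carr(2) ij] using ij by (auto simp: P_def)
  qed (use carr in auto)
  have AP: "A * P = P * F"
  proof (rule eq_matI)
    fix i j assume "i < dim_row (P * F)" "j < dim_col (P * F)"
    then have ij: "i < ?N" "j < ?N" using carr by auto
    have "(A * P) $$ (i, j) = (if j = 0 then k else B i j)"
    proof (cases "j = 0")
      case True
      have "(A * P) $$ (i, j) = (\<Sum>l<?N. B i l)"
        unfolding mult_entry[OF carr(1,2) ij] using ij True by (intro sum.cong) (auto simp: A_def P_def)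
      then show ?thesis using row ij True by simp
    next
      case False
      have "(A * P) $$ (i, j) = (\<Sum>l<?N. if l = j then B i j else 0)"
        unfolding mult_entry[OF carr(1,2) ij] using ij False by (intro sum.cong) (auto simp: A_def P_def)
      then show ?thesis using ij False by (simp del: sum.lessThan_Suc)
    qed
    then show "(A * P) $$ (i, j) = (P * F) $$ (i, j)"
      using ij by (simp add: P_left[OF carr(7)] F_entry)
  qed (use carr in auto)
  have "A = A * (P * Q)" using PQ carr by simp
  also have "\<dots> = P * F * Q" unfolding assoc_mult_mat[OF carr(1,2,3), symmetric] AP ..
  finally have "similar_mat A F" using PQ QP carr by (intro similar_matI[of A F P Q ?N]) auto
  then have "char_poly A = char_poly F" by (rule char_poly_similar)
  also have "\<dots> = char_poly K * char_poly D"
    unfolding F_def by (rule char_poly_four_block_zeros_col) (use carr in auto)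
  also have "char_poly K = [:- k, 1:]"
    using carr by (simp add: char_poly_defs det_single K_def)
  finally show ?thesis unfolding A_def D_def .
qed

text \<open>\<open>Lambda_graph\<close> drops the first entry of the sorted list of roots, so
  exactly one copy of \<open>k\<close> has to be split off. The remaining roots \<open>S\<close> lie
  in \<open>{r, - m}\<close> and include \<open>- m\<close>, hence the maximum is over a nonempty
  set and positive.\<close>

lemma Lambda_graph_bounds:
  assumes "srg {0..<w} E k lam mu"
  shows "Lambda_graph w E > 0" "Lambda_graph w E \<le> max (srg.r k lam mu) (srg.m k lam mu)"
proof -
  interpret srg "{0..<w}" E k lam mu by fact
  obtain x where "x \<in> {0..<w}" using not_complete by blast
  then obtain n where w: "w = Suc n" by (cases w) auto
  have set_w: "{0..<w} = {..<Suc n}" using w by auto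
  define D where "D = mat n n (\<lambda>(i, j). A (Suc i) (Suc j) - A 0 (Suc j))"
  have adjm: "adj_matrix w E = mat (Suc n) (Suc n) (\<lambda>(i, j). A i j)"
    unfolding adj_matrix_def w by (rule eq_matI) (auto simp: A_def)
  have AC: "adj_matrix w E \<in> carrier_mat (Suc n) (Suc n)" and DC: "D \<in> carrier_mat n n"
    by (auto simp: adjm D_def)
  have cp: "char_poly (adj_matrix w E) = [:- real k, 1:] * char_poly D"
    unfolding adjm D_def by (rule char_poly_constant_row_sum) (use sum_A set_w in auto)
  have D0: "char_poly D \<noteq> 0" using degree_monic_char_poly[OF DC] by auto
  define S where "S = proots (char_poly D)"
  have pS: "proots (char_poly (adj_matrix w E)) = add_mset (real k) S"
    unfolding cp using D0 by (subst proots_mult) (auto simp: S_def)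
  have root: "x = r \<or> x = - m" if "x \<in># S" for x
  proof -
    have "poly (char_poly D) x = 0" using that D0 by (simp add: S_def)
    \<comment> \<open>Left eigenvectors are used: prefixed with minus its coordinate sum, one of
      \<open>D\<close> becomes a left eigenvector of the adjacency matrix with sum zero, and there
      the all-ones term of \<open>A_square\<close> vanishes.\<close>
    then have "eigenvalue (transpose_mat D) x"
      using eigenvalue_root_char_poly[of "transpose_mat D" n x] DC by simp
    then obtain y where y: "y \<in> carrier_vec n" "y \<noteq> 0\<^sub>v n" "transpose_mat D *\<^sub>v y = x \<cdot>\<^sub>v y"
      using DC unfolding eigenvalue_def eigenvector_def by auto
    define u where "u = (\<lambda>i. case i of 0 \<Rightarrow> - (\<Sum>i<n. y $ i) | Suc i \<Rightarrow> y $ i)"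
    have u0: "(\<Sum>i<Suc n. u i) = 0" by (simp add: sum.lessThan_Suc_shift u_def del: sum.lessThan_Suc)
    have uS: "(\<Sum>i<Suc n. u i * A i (Suc j)) = x * u (Suc j)" if j: "j < n" for j
    proof -
      have "(transpose_mat D *\<^sub>v y) $ j = (\<Sum>i<n. D $$ (i, j) * y $ i)"
        using j DC y(1) by (simp add: scalar_prod_def atLeast0LessThan)
      also have "\<dots> = (\<Sum>i<n. y $ i * A (Suc i) (Suc j) - y $ i * A 0 (Suc j))"
        using j by (intro sum.cong) (auto simp: D_def algebra_simps)
      also have "\<dots> = (\<Sum>i<Suc n. u i * A i (Suc j))"
        by (simp add: sum.lessThan_Suc_shift u_def sum_subtractf sum_distrib_right del: sum.lessThan_Suc)
      finally show ?thesis using y j by (simp add: u_def)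
    qed
    have uA: "(\<Sum>i<Suc n. u i * A i j) = x * u j" if "j < Suc n" for j
    proof (cases j)
      case (Suc j')
      then show ?thesis using uS that by simp
    next
      \<comment> \<open>The equation at coordinate 0 follows from the others, since both sides have
        total zero over all coordinates.\<close>
      case 0
      have "(\<Sum>j<Suc n. \<Sum>i<Suc n. u i * A i j) = (\<Sum>i<Suc n. u i * (\<Sum>j<Suc n. A i j))"
        by (subst sum.swap) (simp add: sum_distrib_left del: sum.lessThan_Suc)
      also have "\<dots> = (\<Sum>i<Suc n. u i * real k)" using sum_A set_w by (intro sum.cong) auto
      also have "\<dots> = (\<Sum>i<Suc n. u i) * real k" by (rule sum_distrib_right[symmetric])
      finally have "(\<Sum>j<Suc n. \<Sum>i<Suc n. u i * A i j) = 0" unfolding u0 by simp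
      moreover have "(\<Sum>j<Suc n. \<Sum>i<Suc n. u i * A i j)
          = (\<Sum>i<Suc n. u i * A i 0) + (\<Sum>j<n. x * u (Suc j))"
        by (subst sum.lessThan_Suc_shift) (simp add: uS del: sum.lessThan_Suc)
      moreover have "u 0 + (\<Sum>j<n. u (Suc j)) = 0"
        using u0 by (simp add: sum.lessThan_Suc_shift del: sum.lessThan_Suc)
      then have "x * u 0 + (\<Sum>j<n. x * u (Suc j)) = 0"
        by (metis distrib_left mult_zero_right sum_distrib_left)
      ultimately show ?thesis using 0 by simp
    qed
    have "x * x * u j = (real lam - real mu) * (x * u j) + (real k - real mu) * u j" if j: "j < Suc n" for j
    proof -
      have "x * (x * u j) = (\<Sum>i<Suc n. (x * u i) * A i j)"
        unfolding uA[OF j, symmetric] sum_distrib_left by (simp add: mult_ac del: sum.lessThan_Suc)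
      also have "\<dots> = (\<Sum>i<Suc n. (\<Sum>l<Suc n. u l * A l i) * A i j)"
        by (intro sum.cong) (auto simp: uA simp del: sum.lessThan_Suc)
      also have "\<dots> = (\<Sum>i<Suc n. \<Sum>l<Suc n. u l * (A l i * A i j))"
        by (simp only: sum_distrib_right mult.assoc)
      also have "\<dots> = (\<Sum>l<Suc n. \<Sum>i<Suc n. u l * (A l i * A i j))" by (rule sum.swap)
      also have "\<dots> = (\<Sum>l<Suc n. u l * (\<Sum>i\<in>{0..<w}. A l i * A i j))"
        unfolding set_w by (simp add: sum_distrib_left del: sum.lessThan_Suc)
      also have "\<dots> = (\<Sum>l<Suc n. real mu * u l + (real lam - real mu) * (u l * A l j)
          + (if l = j then (real k - real mu) * u j else 0))"
      proof (rule sum.cong[OF refl])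
        fix l assume "l \<in> {..<Suc n}"
        then have "l \<in> {0..<w}" "j \<in> {0..<w}" using j w by auto
        then show "u l * (\<Sum>i\<in>{0..<w}. A l i * A i j) = real mu * u l + (real lam - real mu) * (u l * A l j)
          + (if l = j then (real k - real mu) * u j else 0)"
          by (simp only: A_square) (simp add: algebra_simps)
      qed
      also have "\<dots> = real mu * (\<Sum>l<Suc n. u l) + (real lam - real mu) * (\<Sum>l<Suc n. u l * A l j)
          + (real k - real mu) * u j"
        using j by (simp add: sum.distrib sum_distrib_left del: sum.lessThan_Suc)
      finally show ?thesis unfolding u0 uA[OF j] by simp
    qed
    moreover obtain j where "j < Suc n" "u j \<noteq> 0"
    proof -
      obtain i where "i < n" "y $ i \<noteq> 0" using y(1,2) by (metis eq_vecI carrier_vecD index_zero_vec)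
      then show ?thesis using that[of "Suc i"] by (simp add: u_def)
    qed
    ultimately have "(x * x) * u j = ((real lam - real mu) * x + (real k - real mu)) * u j"
      by (simp add: algebra_simps)
    then have "x * x = (real lam - real mu) * x + (real k - real mu)" using \<open>u j \<noteq> 0\<close> by simp
    then have "(x - r) * (x + m) = 0" by (simp add: k_eq lam_eq algebra_simps)
    then show ?thesis by auto
  qed
  have "r < real k"
  proof -
    have "r * 1 < r * m" using r_pos m_gt_1 by (intro mult_strict_left_mono) auto
    then show ?thesis using k_eq by simp
  qed
  then have le: "x \<le> real k" if "x \<in># S" for x using root[OF that] m_pos by auto
  have S_ne: "S \<noteq> {#}"
  proof -
    define e where "e = (real k - r) / v"
    have e: "e * (real k + m) = real mu" using v_mu v_pos by (simp add: e_def field_simps)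
    \<comment> \<open>A multiple of column 0 of \<open>proj (- r)\<close>, hence an eigenvector for
      \<open>- m\<close>; its entry at 0 is \<open>- r - e < 0\<close>.\<close>
    define u where "u = (\<lambda>z. A z 0 + (if z = 0 then - r else 0) - e)"
    have "(\<Sum>i<Suc n. A j i * u i) = - m * u j" if j: "j < Suc n" for j
    proof -
      have "(\<Sum>i<Suc n. A j i * u i) = (\<Sum>i<Suc n. A j i * A i 0)
          + (\<Sum>i<Suc n. if i = 0 then - r * A j 0 else 0) - e * (\<Sum>i<Suc n. A j i)"
        unfolding sum_distrib_left sum.distrib[symmetric] sum_subtractf[symmetric]
        by (intro sum.cong) (auto simp: u_def algebra_simps)
      also have "(\<Sum>i<Suc n. A j i) = real k" using sum_A[of j] j set_w by auto
      also have "(\<Sum>i<Suc n. A j i * A i 0) = real mu + (real lam - real mu) * A j 0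
          + (if j = 0 then real k - real mu else 0)"
        using A_square[of j 0, unfolded set_w] j by (simp del: sum.lessThan_Suc)
      also have "(\<Sum>i<Suc n. if i = 0 then - r * A j 0 else 0) = - r * A j 0" by simp
      finally have sum_eq: "(\<Sum>i<Suc n. A j i * u i) = (real mu - e * real k) + (real lam - real mu - r) * A j 0
          + (if j = 0 then real k - real mu else 0)"
        by (simp add: algebra_simps del: sum.lessThan_Suc)
      have coeffs: "real mu - e * real k = m * e" "real lam - real mu - r = - m" "real k - real mu = m * r"
        using e lam_eq k_eq by (simp_all add: algebra_simps)
      show ?thesis unfolding sum_eq coeffs by (simp add: u_def algebra_simps)
    qed
    then have "adj_matrix w E *\<^sub>v vec (Suc n) u = (- m) \<cdot>\<^sub>v vec (Suc n) u"
      by (intro eq_vecI) (auto simp: adjm scalar_prod_def atLeast0LessThan simp del: sum.lessThan_Suc)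
    moreover have "vec (Suc n) u \<noteq> 0\<^sub>v (Suc n)"
    proof
      assume "vec (Suc n) u = 0\<^sub>v (Suc n)"
      then have "vec (Suc n) u $ 0 = 0" by simp
      moreover have "e > 0" using \<open>r < real k\<close> v_pos by (simp add: e_def)
      ultimately show False using r_pos irrefl by (simp add: u_def A_def)
    qed
    ultimately have "eigenvalue (adj_matrix w E) (- m)"
      unfolding eigenvalue_def eigenvector_def using AC by (intro exI[of _ "vec (Suc n) u"]) auto
    then have "poly (char_poly (adj_matrix w E)) (- m) = 0"
      using eigenvalue_root_char_poly[OF AC] by simp
    moreover have "poly [:- real k, 1:] (- m) \<noteq> 0" using m_pos by simp
    ultimately have "poly (char_poly D) (- m) = 0" by (simp only: cp poly_mult mult_eq_0_iff simp_thms)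
    then have "- m \<in># S" using D0 by (simp add: S_def)
    then show ?thesis by auto
  qed
  \<comment> \<open>No element of \<open>S\<close> exceeds \<open>k\<close>, so \<open>k\<close> is
    inserted last and comes first after reversal.\<close>
  have xs: "eigenvalues_desc w E = real k # rev (sorted_list_of_multiset S)"
    unfolding eigenvalues_desc_def pS
    by (simp add: sorted_insort_is_snoc le sorted_sorted_list_of_multiset)
  have "{\<bar>eigenvalues_desc w E ! i\<bar> | i. 1 \<le> i \<and> i < length (eigenvalues_desc w E)}
      = (\<lambda>x. \<bar>x\<bar>) ` set_mset S"
  proof -
    let ?ys = "rev (sorted_list_of_multiset S)"
    have "{\<bar>(real k # ?ys) ! i\<bar> | i. 1 \<le> i \<and> i < length (real k # ?ys)} = {\<bar>?ys ! i\<bar> | i. i < length ?ys}"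
      (is "?l = ?r")
    proof
      show "?l \<subseteq> ?r"
      proof
        fix z assume "z \<in> ?l"
        then obtain i where "1 \<le> i" "i < length (real k # ?ys)" "z = \<bar>(real k # ?ys) ! i\<bar>" by blast
        then show "z \<in> ?r" by (cases i) auto
      qed
      show "?r \<subseteq> ?l"
      proof
        fix z assume "z \<in> ?r"
        then obtain i where "i < length ?ys" "z = \<bar>?ys ! i\<bar>" by blast
        then show "z \<in> ?l" by (intro CollectI exI[of _ "Suc i"]) auto
      qed
    qed
    also have "\<dots> = (\<lambda>x. \<bar>x\<bar>) ` set ?ys" unfolding set_conv_nth by blast
    also have "set ?ys = set_mset S" by simp
    finally show ?thesis unfolding xs .
  qed
  then have L: "Lambda_graph w E = Max ((\<lambda>x. \<bar>x\<bar>) ` set_mset S)"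
    by (simp add: Lambda_graph_def Let_def)
  have "Lambda_graph w E \<in> (\<lambda>x. \<bar>x\<bar>) ` set_mset S"
    unfolding L using S_ne by (intro Max_in) auto
  then obtain x where "x \<in># S" "Lambda_graph w E = \<bar>x\<bar>" by blast
  then show "Lambda_graph w E > 0" "Lambda_graph w E \<le> max r m"
    using root[of x] r_pos m_pos by auto
qed

section \<open>Exclusion of the degenerate graphs and the final estimate\<close>

lemma exceptional_imp_srg:
  assumes "exceptional_srg w E k lam mu"
  shows "srg {0..<w} E k lam mu"
proof -
  have sr: "strongly_regular w E k lam mu" and con: "connected_graph w E"
    and nm: "\<not> complete_multipartite_equal w E"
    using assms by (auto simp: exceptional_srg_def)
  have sg: "simple_graph w E" using sr by (simp add: strongly_regular_def)
  have E_in: "x < w \<and> y < w" if "E x y" for x y using sg that by (simp add: simple_graph_def)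
  have E_sym: "E y x" if "E x y" for x y using sg that by (simp add: simple_graph_def)
  have E_irr: "\<not> E x x" for x using sg by (simp add: simple_graph_def)
  have nbr: "{y. y < w \<and> E x y} = {y. E x y}" for x using E_in by blast
  have nbr2: "{z. z < w \<and> E x z \<and> E y z} = {z. E x z \<and> E y z}" for x y using E_in by blast
  note sr' = sr[unfolded strongly_regular_def nbr nbr2]
  have deg: "card {y. E x y} = k" if "x < w" for x using sr' that by simp
  have adj: "card {z. E x z \<and> E y z} = lam" if "E x y" for x y using sr' that E_in[OF that] by simp
  have nonadj: "card {z. E x z \<and> E y z} = mu" if "x < w" "y < w" "x \<noteq> y" "\<not> E x y" for x y
    using sr' that by simp
  have nc: "\<exists>x y. x < w \<and> y < w \<and> x \<noteq> y \<and> \<not> E x y" using sr' by blast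
  have fin: "finite {y. E x y}" for x by (rule finite_subset[of _ "{..<w}"]) (use E_in in auto)
  obtain x0 y0 where xy0: "x0 < w" "y0 < w" "x0 \<noteq> y0" "\<not> E x0 y0" using nc by blast
  \<comment> \<open>With \<open>mu = 0\<close>, adjacency is transitive on distinct vertices, so a
    connected graph would be complete.\<close>
  have "mu \<noteq> 0"
  proof
    assume "mu = 0"
    have trans: "E x z" if "E x y" "E y z" "x \<noteq> z" for x y z
    proof (rule ccontr)
      assume "\<not> E x z"
      then have "card {u. E x u \<and> E z u} = 0" using nonadj[of x z] that E_in \<open>mu = 0\<close> by blast
      moreover have "finite {u. E x u \<and> E z u}" by (rule finite_subset[OF _ fin[of x]]) auto
      moreover have "y \<in> {u. E x u \<and> E z u}" using that E_sym by blast
      ultimately show False by auto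
    qed
    have "E\<^sup>*\<^sup>* x0 y0" using con xy0 by (simp add: connected_graph_def)
    then have "x0 = y0 \<or> E x0 y0" by (induction) (use trans in blast)+
    then show False using xy0 by blast
  qed
  \<comment> \<open>Otherwise non-adjacent vertices have equal neighbourhoods, and non-adjacency is
    an equivalence relation with classes of size \<open>w - k\<close>.\<close>
  moreover have "mu < k"
  proof (rule ccontr)
    assume "\<not> mu < k"
    have sub: "{z. E x z} = {z. E y z}" if xy: "x < w" "y < w" "\<not> E x y" for x y
    proof (cases "x = y")
      case False
      have "{z. E x z \<and> E y z} = {z. E u z}" if "u = x \<or> u = y" for u
      proof (rule card_seteq[OF fin])
        show "{z. E x z \<and> E y z} \<subseteq> {z. E u z}" using that by auto
        show "card {z. E u z} \<le> card {z. E x z \<and> E y z}"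
          using nonadj[OF xy(1,2) False xy(3)] deg that xy \<open>\<not> mu < k\<close> by auto
      qed
      from this[of x] this[of y] show ?thesis by simp
    qed simp
    \<comment> \<open>The least vertex of the class of \<open>x\<close> serves as its label;
      \<open>x\<close> belongs to the set, so the minimum exists.\<close>
    define part where "part = (\<lambda>x. Min {y. y < w \<and> \<not> E x y})"
    have part_iff: "part x = part y \<longleftrightarrow> \<not> E x y" if xy: "x < w" "y < w" for x y
    proof
      assume "\<not> E x y"
      then have "{z. E x z} = {z. E y z}" using sub xy by blast
      then show "part x = part y" unfolding part_def by (metis (no_types, lifting) mem_Collect_eq)
    next
      have mem: "part u < w \<and> \<not> E u (part u)" if "u < w" for u
      proof -
        have "part u \<in> {y. y < w \<and> \<not> E u y}"
          unfolding part_def by (rule Min_in) (use that E_irr in auto)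
        then show ?thesis by simp
      qed
      assume eq: "part x = part y"
      have "\<not> E x (part x)" "\<not> E y (part x)" "part x < w" using mem[OF xy(1)] mem[OF xy(2)] eq by auto
      then have "{z. E x z} = {z. E (part x) z}" "{z. E y z} = {z. E (part x) z}"
        using sub xy by blast+
      then show "\<not> E x y" using E_irr by blast
    qed
    have "card {y. y < w \<and> part y = part x} = w - k" if x: "x < w" for x
    proof -
      have "{y. y < w \<and> part y = part x} = {..<w} - {y. E x y}" using part_iff x E_sym by auto
      moreover have "card ({..<w} - {y. E x y}) = card {..<w} - card {y. E x y}"
        using E_in by (intro card_Diff_subset fin) auto
      ultimately show ?thesis using deg[OF x] by simp
    qed
    then have "complete_multipartite_equal w E"
      unfolding complete_multipartite_equal_def using part_iff by blast
    then show False using nm by simp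
  qed
  moreover have "\<exists>x\<in>{0..<w}. \<exists>y\<in>{0..<w}. x \<noteq> y \<and> \<not> E x y"
    using xy0 by (intro bexI[of _ x0] bexI[of _ y0]) auto
  ultimately show ?thesis
    using E_in E_sym E_irr deg adj nonadj by unfold_locales auto
qed

theorem theorem0p4:
  fixes v k lam mu :: nat and E :: "nat \<Rightarrow> nat \<Rightarrow> bool"
  assumes "exceptional_srg v E k lam mu"
  shows "real k / Lambda_graph v E > real v powr (1/10) / 2"
proof -
  have S: "srg {0..<v} E k lam mu" using assms by (rule exceptional_imp_srg)
  interpret srg "{0..<v}" E k lam mu by (rule S)
  have not_geom: "\<not> (steiner_graph v E \<or> latin_square_graph v E)"
    using assms by (simp add: exceptional_srg_def)
  have v': "srg.v {0..<v} = real v" using v_def by simp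
  \<comment> \<open>The tenth root of this inequality, with \<open>Lambda_graph\<close> at most
    \<open>max r m\<close>, is the claim.\<close>
  have v_less: "real v < 1024 * (real k / max r m) ^ 10"
  proof (cases "r \<le> m")
    case True
    then show ?thesis using v_bound_if_r_le_m v' by (simp add: max_def)
  next
    case False
    then have mr: "m \<le> r" by simp
    show ?thesis
    proof (rule ccontr)
      assume "\<not> ?thesis"
      then have "srg.v {0..<v} \<ge> 1024 * (real k / r) ^ 10" using v' mr by (simp add: max_def split: if_splits)
      from large_r[OF mr this] have big: "31 * m ^ 4 \<le> r" "21 * m\<^sup>2 * real mu \<le> r" by auto
      obtain M :: nat where M: "m = real M" using m_integral[OF mr] .
      define R where "R = nat (int lam - int mu + int M)"
      have r_int: "r = real_of_int (int lam - int mu + int M)" using lam_eq M by simp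
      then have R: "r = real R" using r_pos by (simp add: R_def)
      have "real (31 * M ^ 4) \<le> real R" "real (21 * M\<^sup>2 * mu) \<le> real R" using big M R by simp_all
      then have "31 * M ^ 4 \<le> R" "21 * M\<^sup>2 * mu \<le> R" unfolding of_nat_le_iff .
      then have "claw_srg {0..<v} E k lam mu M R" by unfold_locales (use M R in auto)
      then show False using claw_srg_geometric not_geom by blast
    qed
  qed
  have L: "0 < Lambda_graph v E" "Lambda_graph v E \<le> max r m" using Lambda_graph_bounds[OF S] by auto
  define t where "t = real k / max r m"
  have t: "0 \<le> t" using r_pos by (simp add: t_def)
  have "real v powr (1/10) < ((2 * t) ^ 10) powr (1/10)"
    using v_less unfolding t_def[symmetric] by (intro powr_less_mono2) (auto simp: power_mult_distrib)
  also have "\<dots> = 2 * t"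
  proof (cases "t = 0")
    case False
    then have "(2 * t) ^ 10 = (2 * t) powr 10" using t by (simp add: powr_numeral)
    then show ?thesis using t by (simp only: powr_powr) simp
  qed simp
  finally have "real v powr (1/10) / 2 < t" by simp
  also have "t \<le> real k / Lambda_graph v E"
    unfolding t_def using L by (intro divide_left_mono) (auto intro!: mult_pos_pos simp: r_pos less_max_iff_disj)
  finally show ?thesis .
qed

end
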